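(* Let $A\in\mathbb{H}^{m\times n}$ have rank $r$, let $M$ and $N$ be positive definite quaternion matrices of order $m$ and $n$, and let $A^{\dagger}_{M,N}=(\tilde a^{\dagger}_{ij})\in\mathbb{H}^{n\times m}$ be the weighted Moore-Penrose inverse of $A$. (1) If $A^{\sharp}A$ is Hermitian, then for all $1\le i\le n$, $1\le j\le m$, $$\tilde a^{\dagger}_{ij}=\frac{\sum_{\beta\in J_{r,n}\{i\}}\mathrm{cdet}_i\left(\left(A^{\sharp}A\right)_{.i}\left(a^{\sharp}_{.j}\right)\right)^{\beta}_{\beta}}{\sum_{\beta\in J_{r,n}}\left|\left(A^{\sharp}A\right)^{\beta}_{\beta}\right|}.$$ (2) If $AA^{\sharp}$ is Hermitian, then for all $1\le i\le n$, $1\le j\le m$, $$\tilde a^{\dagger}_{ij}=\frac{\sum_{\alpha\in I_{r,m}\{j\}}\mathrm{rdet}_j\left(\left(AA^{\sharp}\right)_{j.}\left(a^{\sharp}_{i.}\right)\right)^{\alpha}_{\alpha}}{\sum_{\alpha\in I_{r,m}}\left|\left(AA^{\sharp}\right)^{\alpha}_{\alpha}\right|}.$$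
   Context: $\mathbb{H}$ is the skew field of real quaternions; $A^{*}$ is the conjugate transpose; $B$ is Hermitian if $B^{*}=B$; $P$ is positive definite if it is Hermitian and $x^{*}Px>0$ for all nonzero columns $x$. $A^{\sharp}:=N^{-1}A^{*}M$, with $j$-th column $a^{\sharp}_{.j}$ and $i$-th row $a^{\sharp}_{i.}$. $A^{\dagger}_{M,N}$ is the unique $X\in\mathbb{H}^{n\times m}$ with $AXA=A$, $XAX=X$, $(MAX)^{*}=MAX$, $(NXA)^{*}=NXA$. Row and column determinants of $B=(b_{ij})\in\mathbb{H}^{n\times n}$. For fixed $i$, write each $\sigma\in S_n$ as a product of $r=r(\sigma)$ disjoint cycles (1-cycles included) $\sigma=(i\,i_{k_1}\,i_{k_1+1}\ldots i_{k_1+l_1})(i_{k_2}\,i_{k_2+1}\ldots i_{k_2+l_2})\cdots(i_{k_r}\,i_{k_r+1}\ldots i_{k_r+l_r})$, the first cycle starting with $i$, every other cycle starting with its smallest element, and $i_{k_2}<i_{k_3}<\dots<i_{k_r}$. Then $$\mathrm{rdet}_i B=\sum_{\sigma\in S_n}(-1)^{n-r}\,b_{i i_{k_1}}b_{i_{k_1}i_{k_1+1}}\cdots b_{i_{k_1+l_1}i}\cdots b_{i_{k_r}i_{k_r+1}}\cdots b_{i_{k_r+l_r}i_{k_r}}.$$ For fixed $j$, write each $\tau\in S_n$ as $\tau=(j_{k_r+l_r}\ldots j_{k_r+1}\,j_{k_r})\cdots(j_{k_2+l_2}\ldots j_{k_2+1}\,j_{k_2})(j_{k_1+l_1}\ldots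 j_{k_1+1}\,j_{k_1}\,j)$, the last (rightmost) cycle ending with $j$, every other cycle ending with its smallest element, and $j_{k_2}<j_{k_3}<\dots<j_{k_r}$. Then $$\mathrm{cdet}_j B=\sum_{\tau\in S_n}(-1)^{n-r}\,b_{j_{k_r}j_{k_r+l_r}}\cdots b_{j_{k_r+1}j_{k_r}}\cdots b_{j j_{k_1+l_1}}\cdots b_{j_{k_1+1}j_{k_1}}b_{j_{k_1}j}.$$ (A 1-cycle $(s)$ contributes the factor $b_{ss}$.) For Hermitian $B$ all $\mathrm{rdet}_iB$ and $\mathrm{cdet}_iB$ coincide and are real; the common value is $\det B$. $B_{.i}(c)$ (resp. $B_{i.}(c)$) is $B$ with its $i$-th column (resp. row) replaced by the column (resp. row) $c$. $B^{\alpha}_{\alpha}$ is the principal submatrix with rows and columns indexed by $\alpha$; its rows and columns keep their original indices, so that $\mathrm{cdet}_i(B)^{\beta}_{\beta}$ and $\mathrm{rdet}_j(B)^{\alpha}_{\alpha}$ are the column/row determinant of the submatrix along the column/row with original index $i\in\beta$, resp. $j\in\alpha$. For Hermitian $B$, $|B^{\alpha}_{\alpha}|=\det(B^{\alpha}_{\alpha})$. $L_{k,n}$ ($1\le k\le n$) is the set of strictly increasing sequences of $k$ integers from $\{1,\dots,n\}$; $I_{r,m}=L_{r,m}$, $J_{r,n}=L_{r,n}$, $I_{r,m}\{j\}=\{\alpha\in L_{r,m}: j\in\alpha\}$, $J_{r,n}\{i\}=\{\beta\in L_{r,n}: i\in\beta\}$; $r\ge1$ is understood. *)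

theory Defs
  imports "Jordan_Normal_Form.Matrix" "HOL-Combinatorics.Cycles"
begin

section \<open>Quaternions\<close>

datatype quat = Quat (qre: real) (qi: real) (qj: real) (qk: real)

instantiation quat :: division_ring
begin

definition "0 = Quat 0 0 0 0"
definition "1 = Quat 1 0 0 0"
definition "x + y = Quat (qre x + qre y) (qi x + qi y) (qj x + qj y) (qk x + qk y)"
definition "- x = Quat (- qre x) (- qi x) (- qj x) (- qk x)"
definition "x - y = Quat (qre x - qre y) (qi x - qi y) (qj x - qj y) (qk x - qk y)"
definition "x * y = Quat
  (qre x * qre y - qi x * qi y - qj x * qj y - qk x * qk y)
  (qre x * qi y + qi x * qre y + qj x * qk y - qk x * qj y)
  (qre x * qj y - qi x * qk y + qj x * qre y + qk x * qi y)
  (qre x * qk y + qi x * qj y - qj x * qi y + qk x * qre y)"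
definition "inverse x =
  (let s = (qre x)\<^sup>2 + (qi x)\<^sup>2 + (qj x)\<^sup>2 + (qk x)\<^sup>2
   in Quat (qre x / s) (- qi x / s) (- qj x / s) (- qk x / s))"
definition "x div y = x * inverse (y :: quat)"

lemmas quat_defs = zero_quat_def one_quat_def plus_quat_def uminus_quat_def minus_quat_def
  times_quat_def

lemma quat_norm_sq_pos:
  assumes "x \<noteq> (0 :: quat)"
  shows "(qre x)\<^sup>2 + (qi x)\<^sup>2 + (qj x)\<^sup>2 + (qk x)\<^sup>2 > 0"
proof -
  have "qre x \<noteq> 0 \<or> qi x \<noteq> 0 \<or> qj x \<noteq> 0 \<or> qk x \<noteq> 0"
    using assms by (cases x) (auto simp: zero_quat_def)
  then show ?thesis
    by (smt (verit) zero_le_power2 zero_less_power2)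
qed

instance
proof
  fix x :: quat
  assume nz: "x \<noteq> 0"
  define s where "s = (qre x)\<^sup>2 + (qi x)\<^sup>2 + (qj x)\<^sup>2 + (qk x)\<^sup>2"
  have s: "s > 0" unfolding s_def by (rule quat_norm_sq_pos[OF nz])
  have e: "qre x * qre x + qi x * qi x + qj x * qj x + qk x * qk x = s"
    by (simp add: s_def power2_eq_square)
  have i: "inverse x = Quat (qre x / s) (- qi x / s) (- qj x / s) (- qk x / s)"
    by (simp add: inverse_quat_def s_def Let_def)
  show "inverse x * x = 1" "x * inverse x = 1"
    using s e by (simp_all add: i quat_defs field_simps)
qed (auto simp: quat_defs divide_quat_def inverse_quat_def algebra_simps)

end

definition quat_of_real :: "real \<Rightarrow> quat" where
  "quat_of_real t = Quat t 0 0 0"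

definition qcnj :: "quat \<Rightarrow> quat" where
  "qcnj x = Quat (qre x) (- qi x) (- qj x) (- qk x)"


section \<open>Quaternion matrices\<close>

text \<open>
  Matrices carry their dimensions; rows and columns are numbered from 0, so the index range
  from 1 to n is rendered as the numbers below n.
\<close>

definition qadj :: "quat mat \<Rightarrow> quat mat" where
  "qadj A = map_mat qcnj (transpose_mat A)"

definition qhermitian :: "quat mat \<Rightarrow> bool" where
  "qhermitian B \<longleftrightarrow> qadj B = B"

definition qpositive_definite :: "quat mat \<Rightarrow> bool" where
  "qpositive_definite P \<longleftrightarrow> qhermitian P \<and>
     (\<forall>x \<in> carrier_vec (dim_row P). x \<noteq> 0\<^sub>v (dim_row P) \<longrightarrow>
        (\<exists>t > 0. map_vec qcnj x \<bullet> (P *\<^sub>v x) = quat_of_real t))"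

definition qmat_inv :: "quat mat \<Rightarrow> quat mat" where
  "qmat_inv N = (THE X. inverts_mat N X \<and> inverts_mat X N)"

text \<open>
  Columns are regarded as a right vector space: coefficients multiply from the right. The column
  rank over this right vector space is the rank of the matrix. Independence refers to the family
  of columns with indices in \<open>S\<close>, so two equal columns are dependent.
\<close>

definition right_indep_cols :: "quat mat \<Rightarrow> nat set \<Rightarrow> bool" where
  "right_indep_cols A S \<longleftrightarrow>
     (\<forall>c. (\<forall>i < dim_row A. (\<Sum>j\<in>S. A $$ (i, j) * c j) = 0) \<longrightarrow> (\<forall>j\<in>S. c j = 0))"

definition qrank :: "quat mat \<Rightarrow> nat" where
  "qrank A = Max {card S | S. S \<subseteq> {..<dim_col A} \<and> right_indep_cols A S}"

definition wsharp :: "quat mat \<Rightarrow> quat mat \<Rightarrow> quat mat \<Rightarrow> quat mat" where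
  "wsharp M N A = qmat_inv N * qadj A * M"

definition is_weighted_MP_inverse :: "quat mat \<Rightarrow> quat mat \<Rightarrow> quat mat \<Rightarrow> quat mat \<Rightarrow> bool" where
  "is_weighted_MP_inverse M N A X \<longleftrightarrow>
     X \<in> carrier_mat (dim_col A) (dim_row A) \<and>
     A * X * A = A \<and> X * A * X = X \<and>
     qadj (M * A * X) = M * A * X \<and> qadj (N * X * A) = N * X * A"

definition weighted_MP_inverse :: "quat mat \<Rightarrow> quat mat \<Rightarrow> quat mat \<Rightarrow> quat mat" where
  "weighted_MP_inverse M N A = (THE X. is_weighted_MP_inverse M N A X)"

definition replace_col :: "quat mat \<Rightarrow> nat \<Rightarrow> quat vec \<Rightarrow> quat mat" where
  "replace_col B i c =
     mat (dim_row B) (dim_col B) (\<lambda>(k, l). if l = i then c $ k else B $$ (k, l))"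

definition replace_row :: "quat mat \<Rightarrow> nat \<Rightarrow> quat vec \<Rightarrow> quat mat" where
  "replace_row B j c =
     mat (dim_row B) (dim_col B) (\<lambda>(k, l). if k = j then c $ l else B $$ (k, l))"


section \<open>Row and column determinants\<close>

text \<open>
  The determinants below take a set \<open>\<alpha>\<close> of indices as their first argument and are those of the
  principal submatrix of \<open>B\<close> with rows and columns in \<open>\<alpha>\<close>, where rows and columns keep their
  original indices; \<open>{..<n}\<close> gives the determinants of an \<open>n \<times> n\<close> matrix itself.

  The list \<open>cycle_heads \<alpha> i \<sigma>\<close> contains one element of each cycle of the permutation \<open>\<sigma>\<close> of \<open>\<alpha>\<close>,
  fixed points included: first \<open>i\<close>, then the least elements of the cycles that do not
  contain \<open>i\<close>, in increasing order. Here \<open>support \<sigma> s\<close> is the list \<open>[s, \<sigma> s, \<sigma> (\<sigma> s), \<dots>]\<close> that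
  runs once through the cycle of \<open>s\<close>.

  The word \<open>cycle_prod B \<sigma> s\<close> is the product of the entries at \<open>(s, \<sigma> s)\<close>, \<open>(\<sigma> s, \<sigma> (\<sigma> s))\<close>, and
  so on until the column index returns to \<open>s\<close>. It is the factor belonging to one cycle in both kinds
  of determinant: the column determinant writes a cycle from right to left with its head \<open>s\<close> at
  the right end, but as a permutation this cycle is read from left to right, so it sends \<open>s\<close>
  to the leftmost entry and its factor again begins in row \<open>s\<close> and ends in column \<open>s\<close>. Only the
  order of the cycles is reversed.
\<close>

definition cycle_heads :: "nat set \<Rightarrow> nat \<Rightarrow> (nat \<Rightarrow> nat) \<Rightarrow> nat list" where
  "cycle_heads \<alpha> i \<sigma> =
     i # sorted_list_of_set
           {s \<in> \<alpha>. i \<notin> set (support \<sigma> s) \<and> (\<forall>t \<in> set (support \<sigma> s). s \<le> t)}"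

definition cycle_prod :: "quat mat \<Rightarrow> (nat \<Rightarrow> nat) \<Rightarrow> nat \<Rightarrow> quat" where
  "cycle_prod B \<sigma> s = prod_list (map (\<lambda>t. B $$ (t, \<sigma> t)) (support \<sigma> s))"

definition rdet :: "nat set \<Rightarrow> nat \<Rightarrow> quat mat \<Rightarrow> quat" where
  "rdet \<alpha> i B =
     (\<Sum>\<sigma> | \<sigma> permutes \<alpha>. (- 1) ^ (card \<alpha> - length (cycle_heads \<alpha> i \<sigma>)) *
        prod_list (map (cycle_prod B \<sigma>) (cycle_heads \<alpha> i \<sigma>)))"

definition cdet :: "nat set \<Rightarrow> nat \<Rightarrow> quat mat \<Rightarrow> quat" where
  "cdet \<alpha> j B =
     (\<Sum>\<tau> | \<tau> permutes \<alpha>. (- 1) ^ (card \<alpha> - length (cycle_heads \<alpha> j \<tau>)) *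
        prod_list (map (cycle_prod B \<tau>) (rev (cycle_heads \<alpha> j \<tau>))))"

text \<open>
  The common value of all row and column determinants, meaningful only if the submatrix is
  Hermitian and \<open>\<alpha>\<close> is nonempty.
\<close>

definition hdet :: "nat set \<Rightarrow> quat mat \<Rightarrow> quat" where
  "hdet \<alpha> B = (THE d. \<forall>i\<in>\<alpha>. rdet \<alpha> i B = d \<and> cdet \<alpha> i B = d)"

text \<open>Strictly increasing sequences of length \<open>k\<close> are identified with their sets of members.\<close>

definition index_sets :: "nat \<Rightarrow> nat \<Rightarrow> nat set set" where
  "index_sets k n = {\<alpha>. \<alpha> \<subseteq> {..<n} \<and> card \<alpha> = k}"

end

theory Submission
  imports Defs
begin

text \<open>
  Reversing a cycle conjugates its word, so for a Hermitian \<open>B\<close> only real parts of cycle words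
  survive in the row and column determinants; they are real and independent of the chosen index.
  Expanding along the path through that index writes the entries of the adjugate of a principal
  submatrix as sums over simple paths weighted by smaller principal minors. Let \<open>S\<^sub>k\<close> be the sum
  of these adjugates and \<open>d\<^sub>k\<close> the sum of the principal minors of size \<open>k\<close>. A sign-reversing
  exchange between a path and the cycle that closes it gives \<open>S\<^sub>k\<^sub>+\<^sub>1 = d\<^sub>k I - S\<^sub>k B\<close>, without
  polynomials or limits. For the largest \<open>s\<close> with \<open>d\<^sub>s \<noteq> 0\<close> this forces \<open>S\<^sub>s B B = d\<^sub>s B\<close>, so
  \<open>S\<^sub>s B / d\<^sub>s\<close> is the projector onto the range of \<open>B\<close>; its real trace is both \<open>s\<close> and the rank,
  whence \<open>s = r\<close>. If the columns of \<open>X\<close> lie in the range of \<open>B\<close>, then \<open>S\<^sub>r (B X) = d\<^sub>r X\<close>, which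
  is Cramer's rule. The weighted Moore-Penrose inverse satisfies this for \<open>B = A\<^sup>\<sharp> A\<close>, and its
  adjoint does for \<open>B = A A\<^sup>\<sharp>\<close>.
\<close>

section \<open>Conjugation and real quaternions\<close>

lemma quat_eq_iff: "x = y \<longleftrightarrow> qre x = qre y \<and> qi x = qi y \<and> qj x = qj y \<and> qk x = qk y"
  by (cases x; cases y) auto

lemma quat_components [simp]:
  "qre 0 = 0" "qi 0 = 0" "qj 0 = 0" "qk 0 = 0"
  "qre 1 = 1" "qi 1 = 0" "qj 1 = 0" "qk 1 = 0"
  "qre (x + y) = qre x + qre y" "qi (x + y) = qi x + qi y"
  "qj (x + y) = qj x + qj y" "qk (x + y) = qk x + qk y"
  "qre (- x) = - qre x" "qi (- x) = - qi x" "qj (- x) = - qj x" "qk (- x) = - qk x"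
  "qre (x - y) = qre x - qre y" "qi (x - y) = qi x - qi y"
  "qj (x - y) = qj x - qj y" "qk (x - y) = qk x - qk y"
  "qre (qcnj x) = qre x" "qi (qcnj x) = - qi x" "qj (qcnj x) = - qj x" "qk (qcnj x) = - qk x"
  "qre (quat_of_real t) = t" "qi (quat_of_real t) = 0"
  "qj (quat_of_real t) = 0" "qk (quat_of_real t) = 0"
  by (simp_all add: quat_defs qcnj_def quat_of_real_def)

lemma quat_times_components:
  "qre (x * y) = qre x * qre y - qi x * qi y - qj x * qj y - qk x * qk y"
  "qi (x * y) = qre x * qi y + qi x * qre y + qj x * qk y - qk x * qj y"
  "qj (x * y) = qre x * qj y - qi x * qk y + qj x * qre y + qk x * qi y"
  "qk (x * y) = qre x * qk y + qi x * qj y - qj x * qi y + qk x * qre y"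
  by (simp_all add: quat_defs)

lemma qre_commute: "qre (x * y) = qre (y * x)"
  by (simp add: quat_times_components)

lemma qcnj_simps [simp]:
  "qcnj 0 = 0" "qcnj 1 = 1" "qcnj (qcnj x) = x" "qcnj (x + y) = qcnj x + qcnj y"
  "qcnj (- x) = - qcnj x" "qcnj (x - y) = qcnj x - qcnj y" "qcnj (x * y) = qcnj y * qcnj x"
  "qcnj (quat_of_real t) = quat_of_real t"
  by (simp_all add: quat_eq_iff quat_times_components algebra_simps)

lemma qcnj_power [simp]: "qcnj (x ^ k) = qcnj x ^ k"
  by (induction k) (simp_all add: power_commutes)

lemma qcnj_sum: "qcnj (sum f S) = (\<Sum>x\<in>S. qcnj (f x))"
  by (induction S rule: infinite_finite_induct) auto

lemma qre_sum: "qre (sum f S) = (\<Sum>x\<in>S. qre (f x))"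
  by (induction S rule: infinite_finite_induct) auto

lemma quat_of_real_simps [simp]:
  "quat_of_real 0 = 0" "quat_of_real 1 = 1"
  "quat_of_real (s + t) = quat_of_real s + quat_of_real t"
  "quat_of_real (- t) = - quat_of_real t"
  "quat_of_real (s * t) = quat_of_real s * quat_of_real t"
  "quat_of_real (s ^ k) = quat_of_real s ^ k"
  "quat_of_real s = quat_of_real t \<longleftrightarrow> s = t"
  "quat_of_real t = 0 \<longleftrightarrow> t = 0"
proof -
  show m: "quat_of_real (s * t) = quat_of_real s * quat_of_real t" for s t
    by (simp add: quat_eq_iff quat_times_components)
  show "quat_of_real (s ^ k) = quat_of_real s ^ k"
    by (induction k) (simp_all add: m, simp add: quat_eq_iff)
qed (simp_all add: quat_eq_iff)

lemma quat_of_real_sum: "quat_of_real (sum f S) = (\<Sum>x\<in>S. quat_of_real (f x))"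
  by (induction S rule: infinite_finite_induct) auto

lemma quat_of_real_commute: "quat_of_real t * x = x * quat_of_real t"
  by (simp add: quat_eq_iff quat_times_components)

lemma qre_quat_of_real_times [simp]: "qre (quat_of_real t * x) = t * qre x"
  by (simp add: quat_times_components)

lemma quat_of_real_left_commute: "x * (quat_of_real t * y) = quat_of_real t * (x * y)"
  by (metis mult.assoc quat_of_real_commute)

lemma qcnj_fixed_iff: "qcnj x = x \<longleftrightarrow> x = quat_of_real (qre x)"
  by (auto simp: quat_eq_iff)

lemma qcnj_divide_real: "qcnj (x / quat_of_real t) = qcnj x / quat_of_real t"
proof -
  \<comment> \<open>At \<open>t = 0\<close> both sides vanish, because real division by zero gives
    zero.\<close>
  have "inverse (quat_of_real t) = quat_of_real (inverse t)"
    by (cases "t = 0") (simp_all add: inverse_quat_def Let_def power2_eq_square quat_of_real_def zero_quat_def field_simps)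
  then show ?thesis by (simp add: divide_quat_def quat_of_real_commute)
qed

lemma sign_commute: "x * (- 1 :: quat) ^ k = (- 1) ^ k * x"
  by (cases "even k") simp_all

lemma sign_inner_commute: "s * (- 1 :: quat) ^ k * (x * y) = s * (x * ((- 1) ^ k * y))"
  by (cases "even k") simp_all

text \<open>Signs and real factors are central and move to the front; the words \<open>x\<close> and
  \<open>y\<close> do not commute and keep their order.\<close>

lemma sign_real_rearrange:
  "(- 1) ^ a * (x * ((- 1) ^ b * (y * quat_of_real t))) =
    (- 1) ^ (a + b) * (quat_of_real t * (x * y))"
proof -
  have "x * (y * quat_of_real t) = quat_of_real t * (x * y)"
    by (simp only: quat_of_real_commute mult.assoc)
  then show ?thesis by (cases "even a"; cases "even b") simp_all
qed

section \<open>Words along paths\<close>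

text \<open>List entries are vertices and the factors sit on the edges, so a single vertex has
  weight 1. A cycle is written with its head repeated at the end.\<close>

fun path_prod :: "quat mat \<Rightarrow> nat list \<Rightarrow> quat" where
  "path_prod B (x # y # zs) = B $$ (x, y) * path_prod B (y # zs)"
| "path_prod B zs = 1"

lemma path_prod_append: "path_prod B (xs @ y # zs) = path_prod B (xs @ [y]) * path_prod B (y # zs)"
  by (induction B xs rule: path_prod.induct) (auto simp: mult.assoc)

lemma path_prod_snoc:
  "xs \<noteq> [] \<Longrightarrow> path_prod B (xs @ [y]) = path_prod B xs * B $$ (last xs, y)"
  by (induction B xs rule: path_prod.induct) (auto simp: mult.assoc)

text \<open>Conjugation reverses products, and the entrywise adjoint relation turns every reversed
  edge into the conjugate of the original one.\<close>

lemma path_prod_rev: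
  assumes "\<And>x y. x \<in> set xs \<Longrightarrow> y \<in> set xs \<Longrightarrow> C $$ (y, x) = qcnj (B $$ (x, y))"
  shows "path_prod C (rev xs) = qcnj (path_prod B xs)"
  using assms
proof (induction B xs rule: path_prod.induct)
  case (1 B x y zs)
  have "path_prod C (rev (x # y # zs)) = path_prod C (rev zs @ y # [x])" by simp
  also have "\<dots> = path_prod C (rev (y # zs)) * C $$ (y, x)"
    by (subst path_prod_append) simp
  also have "path_prod C (rev (y # zs)) = qcnj (path_prod B (y # zs))"
    using 1 by (metis list.set_intros(2))
  also have "C $$ (y, x) = qcnj (B $$ (x, y))" using 1(2) by (meson list.set_intros)
  also have "qcnj (path_prod B (y # zs)) * qcnj (B $$ (x, y)) = qcnj (path_prod B (x # y # zs))"
    by simp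
  finally show ?case .
qed auto

text \<open>Only the vertices in \<open>butlast xs\<close> occur as rows and those in
  \<open>tl xs\<close> as columns. A path starting at \<open>i\<close> therefore does not see a
  change of column \<open>i\<close>.\<close>

lemma path_prod_cong:
  assumes "\<forall>x\<in>set (butlast xs). \<forall>y\<in>set (tl xs). B $$ (x, y) = C $$ (x, y)"
  shows "path_prod B xs = path_prod C xs"
  using assms by (induction B xs rule: path_prod.induct) (auto split: if_splits)

section \<open>Simple paths, represented by the ordered lists of their interior vertices\<close>

definition distinct_lists :: "'a set \<Rightarrow> 'a list set" where
  "distinct_lists \<gamma> = {l. distinct l \<and> set l \<subseteq> \<gamma>}"

lemma distinct_listsD:
  assumes "l \<in> distinct_lists (\<gamma> - {i})" 
  shows "i \<notin> set l" "set l \<subseteq> \<gamma>" "distinct l" "set l \<subseteq> \<gamma> - {i}"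
  using assms by (auto simp: distinct_lists_def)

lemma finite_distinct_lists [simp]: "finite \<gamma> \<Longrightarrow> finite (distinct_lists \<gamma>)"
  unfolding distinct_lists_def
  by (rule finite_subset[OF _ finite_lists_length_le[of \<gamma> "card \<gamma>"]])
     (auto, metis card_mono distinct_card)

lemma rev_in_distinct_lists [simp]: "rev l \<in> distinct_lists \<gamma> \<longleftrightarrow> l \<in> distinct_lists \<gamma>"
  by (auto simp: distinct_lists_def)

lemma sum_distinct_lists_rev:
  "(\<Sum>l\<in>distinct_lists \<gamma>. f (rev l)) = (\<Sum>l\<in>distinct_lists \<gamma>. f l)"
  by (rule sum.reindex_bij_witness[of _ rev rev]) auto

text \<open>A distinct list either avoids \<open>j\<close> or is cut at \<open>j\<close> in exactly
  one way. This is how a path through \<open>j\<close> is later compared with a path and a disjoint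
  cycle through \<open>j\<close>.\<close>

lemma sum_distinct_lists_split:
  assumes "finite \<delta>" "j \<notin> \<delta>"
  shows "(\<Sum>l\<in>distinct_lists (insert j \<delta>). f l) = (\<Sum>l\<in>distinct_lists \<delta>. f l) +
    (\<Sum>u\<in>distinct_lists \<delta>. \<Sum>v\<in>distinct_lists (\<delta> - set u). f (u @ j # v))"
proof -
  let ?A = "{l \<in> distinct_lists (insert j \<delta>). j \<in> set l}"
  let ?P = "SIGMA u:distinct_lists \<delta>. distinct_lists (\<delta> - set u)"
  have e: "distinct_lists (insert j \<delta>) = distinct_lists \<delta> \<union> ?A"
    by (auto simp: distinct_lists_def)
  have inj: "inj_on (\<lambda>(u, v). u @ j # v) ?P"
  proof (intro inj_onI)
    fix p q assume "p \<in> ?P" "q \<in> ?P" and e: "(\<lambda>(u, v). u @ j # v) p = (\<lambda>(u, v). u @ j # v) q"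
    moreover obtain u v u' v' where pq: "p = (u, v)" "q = (u', v')" by (cases p; cases q)
    ultimately have "j \<notin> set u" "j \<notin> set v" using assms(2) by (auto simp: distinct_lists_def)
    with e show "p = q" by (simp add: pq append_Cons_eq_iff)
  qed
  have im: "(\<lambda>(u, v). u @ j # v) ` ?P = ?A"
  proof (intro equalityI subsetI)
    fix l assume l: "l \<in> ?A"
    then obtain u v where "l = u @ j # v" by (auto dest: split_list)
    with l show "l \<in> (\<lambda>(u, v). u @ j # v) ` ?P"
      by (auto simp: distinct_lists_def intro!: image_eqI[where x = "(u, v)"])
  qed (use assms(2) in \<open>auto simp: distinct_lists_def\<close>)
  have "sum f ?A = (\<Sum>(u, v)\<in>?P. f (u @ j # v))"
    unfolding im[symmetric] by (subst sum.reindex[OF inj]) (simp add: case_prod_unfold)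
  also have "\<dots> = (\<Sum>u\<in>distinct_lists \<delta>. \<Sum>v\<in>distinct_lists (\<delta> - set u). f (u @ j # v))"
    using assms(1) by (subst sum.Sigma) auto
  finally have "sum f ?A = \<dots>" .
  moreover have "finite ?A" using assms(1) by simp
  moreover have "distinct_lists \<delta> \<inter> ?A = {}" using assms(2) by (auto simp: distinct_lists_def)
  ultimately show ?thesis using assms(1) by (subst e, subst sum.union_disjoint) simp_all
qed

text \<open>Disjointness of two lists is symmetric, so either may be chosen first.\<close>

lemma sum_distinct_lists_swap:
  assumes "finite \<delta>"
  shows "(\<Sum>u\<in>distinct_lists \<delta>. \<Sum>v\<in>distinct_lists (\<delta> - set u). f u v) =
    (\<Sum>v\<in>distinct_lists \<delta>. \<Sum>u\<in>distinct_lists (\<delta> - set v). f u v)"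
proof -
  have "(\<Sum>(u,v)\<in>(SIGMA u:distinct_lists \<delta>. distinct_lists (\<delta> - set u)). f u v) =
     (\<Sum>(v,u)\<in>(SIGMA v:distinct_lists \<delta>. distinct_lists (\<delta> - set v)). f u v)"
    by (rule sum.reindex_bij_witness[of _ prod.swap prod.swap]) (auto simp: distinct_lists_def)
  then show ?thesis using assms by (simp add: sum.Sigma)
qed

section \<open>Splitting off the cycle of a given index\<close>

text \<open>Replaces iterates of the permutation by one equation: a distinct list runs through the
  cycle of \<open>i\<close> iff the permutation shifts it by one place with wraparound.\<close>

lemma support_eq_iff:
  assumes "permutation \<sigma>" and "distinct (i # l)"
  shows "support \<sigma> i = i # l \<longleftrightarrow> map \<sigma> (i # l) = l @ [i]"
proof
  let ?n = "least_power \<sigma> i"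
  assume s: "support \<sigma> i = i # l"
  have n: "?n = Suc (length l)" using arg_cong[OF s, of length] by simp
  have nth: "(i # l) ! k = (\<sigma> ^^ k) i" if "k < ?n" for k
    using that by (subst s[symmetric]) simp
  show "map \<sigma> (i # l) = l @ [i]"
  proof (rule nth_equalityI)
    fix k assume "k < length (map \<sigma> (i # l))"
    then have k: "k < ?n" using n by simp
    have "map \<sigma> (i # l) ! k = (\<sigma> ^^ Suc k) i" using k nth[of k] n by (subst nth_map) simp_all
    also have "\<dots> = (l @ [i]) ! k"
    proof (cases "Suc k < ?n")
      case True
      with nth[of "Suc k"] n show ?thesis by (simp add: nth_append)
    next
      \<comment> \<open>At the last position the full period has been used up and the orbit is back
        at \<open>i\<close>.\<close>
      case False
      then have "Suc k = ?n" using k by simp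
      then show ?thesis using least_power_of_permutation(1)[OF assms(1), of i] n
        by (simp add: nth_append)
    qed
    finally show "map \<sigma> (i # l) ! k = (l @ [i]) ! k" .
  qed simp
next
  let ?x = "i # l" and ?n = "Suc (length l)"
  assume m: "map \<sigma> (i # l) = l @ [i]"
  have step: "\<sigma> (?x ! k) = (l @ [i]) ! k" if "k < ?n" for k
    using that by (subst m[symmetric], subst nth_map) simp_all
  have pow: "(\<sigma> ^^ k) i = ?x ! k" if "k < ?n" for k
    using that
  proof (induction k)
    case (Suc k)
    then have "(\<sigma> ^^ Suc k) i = (l @ [i]) ! k" using step[of k] by simp
    then show ?case using Suc.prems by (simp add: nth_append)
  qed simp
  have "(\<sigma> ^^ ?n) i = i" using pow[of "length l"] step[of "length l"] by simp
  \<comment> \<open>An earlier return to \<open>i\<close> would repeat an entry of a distinct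
    list.\<close>
  moreover have "?n \<le> k" if "(\<sigma> ^^ k) i = i \<and> k > 0" for k
  proof (rule ccontr)
    assume "\<not> ?n \<le> k"
    then have "?x ! k = ?x ! 0" using pow[of k] that by simp
    with \<open>\<not> ?n \<le> k\<close> that show False
      using nth_eq_iff_index_eq[OF assms(2), of k 0] by simp
  qed
  ultimately have "least_power \<sigma> i = ?n"
    unfolding least_power_def by (intro Least_equality) auto
  then have "support \<sigma> i = map (\<lambda>k. ?x ! k) [0..<length ?x]" using pow by simp
  then show "support \<sigma> i = ?x" by (simp only: map_nth)
qed

lemma support_Cons:
  assumes "permutation \<sigma>"
  shows "support \<sigma> i = i # tl (support \<sigma> i)" "i \<in> set (support \<sigma> i)"
proof -
  show "support \<sigma> i = i # tl (support \<sigma> i)"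
    using least_power_of_permutation(2)[OF assms, of i] by (simp add: upt_conv_Cons del: upt_Suc)
  then show "i \<in> set (support \<sigma> i)" by (metis list.set_intros(1))
qed

lemma support_subset:
  assumes "\<sigma> permutes \<alpha>" "s \<in> \<alpha>"
  shows "set (support \<sigma> s) \<subseteq> \<alpha>"
  using assms permutes_in_image[OF permutes_funpow[OF assms(1)]] by auto

lemma prod_list_entries_eq_path_prod:
  assumes "map \<sigma> (x # xs) = xs @ [y]"
  shows "prod_list (map (\<lambda>t. B $$ (t, \<sigma> t)) (x # xs)) = path_prod B (x # xs @ [y])"
  using assms by (induction xs arbitrary: x) auto

text \<open>What is left of \<open>cycle_heads\<close> once the cycle of the distinguished index is
  removed.\<close>

definition least_cycle_heads :: "nat set \<Rightarrow> (nat \<Rightarrow> nat) \<Rightarrow> nat list" where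
  "least_cycle_heads \<gamma> \<sigma> = sorted_list_of_set {s \<in> \<gamma>. \<forall>t \<in> set (support \<sigma> s). s \<le> t}"

lemma length_least_cycle_heads: "finite \<gamma> \<Longrightarrow> length (least_cycle_heads \<gamma> \<sigma>) \<le> card \<gamma>"
  by (auto simp: least_cycle_heads_def intro: card_mono)

text \<open>The minimum is the least element of its own cycle and comes first in sorted order, so
  distinguishing it changes nothing.\<close>

lemma cycle_heads_Min:
  assumes "finite \<gamma>" "\<gamma> \<noteq> {}" "\<sigma> permutes \<gamma>"
  shows "cycle_heads \<gamma> (Min \<gamma>) \<sigma> = least_cycle_heads \<gamma> \<sigma>"
proof -
  have perm: "permutation \<sigma>" using assms by (auto simp: permutation_permutes)
  let ?m = "Min \<gamma>"
  let ?X = "{s \<in> \<gamma>. ?m \<notin> set (support \<sigma> s) \<and> (\<forall>t \<in> set (support \<sigma> s). s \<le> t)}"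
  have m: "?m \<in> \<gamma>" "\<And>t. t \<in> \<gamma> \<Longrightarrow> ?m \<le> t" using assms by auto
  have 1: "{s \<in> \<gamma>. \<forall>t \<in> set (support \<sigma> s). s \<le> t} = insert ?m ?X"
  proof (intro equalityI subsetI)
    fix s assume "s \<in> {s \<in> \<gamma>. \<forall>t \<in> set (support \<sigma> s). s \<le> t}"
    then show "s \<in> insert ?m ?X" using m(2)[of s] by fastforce
  next
    fix s assume "s \<in> insert ?m ?X"
    then show "s \<in> {s \<in> \<gamma>. \<forall>t \<in> set (support \<sigma> s). s \<le> t}"
      using m support_subset[OF assms(3), of ?m] by blast
  qed
  have 2: "?m \<notin> ?X" using support_Cons(2)[OF perm] by blast
  have 3: "finite ?X" using assms by simp
  have "sorted_list_of_set (insert ?m ?X) = insort ?m (sorted_list_of_set ?X)"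
    using 2 3 by (subst sorted_list_of_set_insert_remove) simp_all
  also have "\<dots> = ?m # sorted_list_of_set ?X"
    using m(2) 3 by (intro insort_is_Cons) auto
  finally show ?thesis unfolding cycle_heads_def least_cycle_heads_def 1 by simp
qed

text \<open>Permutations of \<open>\<alpha>\<close> whose cycle through \<open>i\<close> is
  \<open>i # l\<close> correspond to permutations of the remaining indices;
  \<open>restrict_rest\<close> and \<open>add_cycle\<close> are the two directions of this
  bijection.\<close>

locale split_cycle =
  fixes \<alpha> :: "nat set" and i :: nat and l :: "nat list"
  assumes fin: "finite \<alpha>" and i: "i \<in> \<alpha>" and l: "l \<in> distinct_lists (\<alpha> - {i})"
begin

definition "rest = \<alpha> - {i} - set l"
definition "restrict_rest \<sigma> = (\<lambda>y. if y \<in> rest then \<sigma> y else y)" for \<sigma> :: "nat \<Rightarrow> nat"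
definition "add_cycle \<sigma> = cycle_of_list (i # l) \<circ> \<sigma>"
definition "with_cycle = {\<sigma>. \<sigma> permutes \<alpha> \<and> map \<sigma> (i # l) = l @ [i]}"

lemma dist: "distinct (i # l)" and sub: "set (i # l) \<subseteq> \<alpha>"
  using l i by (auto simp: distinct_lists_def)

lemma rest_eq: "rest = \<alpha> - set (i # l)"
  by (auto simp: rest_def)

lemma map_cycle: "map (cycle_of_list (i # l)) (i # l) = l @ [i]"
  using cyclic_rotation[OF dist, of 1] by (simp del: cycle_of_list.simps)

lemma cycle_fix: "x \<notin> set (i # l) \<Longrightarrow> cycle_of_list (i # l) x = x"
  by (rule id_outside_supp)

lemma with_cycle_support:
  assumes "\<sigma> \<in> with_cycle"
  shows "support \<sigma> i = i # l" "permutation \<sigma>" "\<sigma> permutes \<alpha>"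
proof -
  show p: "permutation \<sigma>" "\<sigma> permutes \<alpha>"
    using assms fin by (auto simp: with_cycle_def permutation_permutes)
  show "support \<sigma> i = i # l"
    using assms by (subst support_eq_iff[OF p(1) dist]) (simp add: with_cycle_def)
qed

lemma restrict_rest_permutes:
  assumes "\<sigma> \<in> with_cycle"
  shows "restrict_rest \<sigma> permutes rest"
  using semidecomposition[OF with_cycle_support(3)[OF assms] fin, of i]
  unfolding with_cycle_support(1)[OF assms] restrict_rest_def rest_eq .

lemma add_cycle_restrict_rest:
  assumes "\<sigma> \<in> with_cycle"
  shows "add_cycle (restrict_rest \<sigma>) = \<sigma>"
proof
  fix x
  consider "x \<in> set (i # l)" | "x \<in> rest" | "x \<notin> \<alpha>" unfolding rest_eq by blast
  then show "add_cycle (restrict_rest \<sigma>) x = \<sigma> x"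
  proof cases
    case 1
    then have "restrict_rest \<sigma> x = x" by (auto simp: restrict_rest_def rest_eq)
    moreover have "map (cycle_of_list (i # l)) (i # l) = map \<sigma> (i # l)"
      using assms map_cycle by (simp add: with_cycle_def)
    ultimately show ?thesis using 1 unfolding add_cycle_def o_def by (metis map_eq_conv)
  next
    case 2
    then have "restrict_rest \<sigma> x \<in> rest"
      using permutes_in_image[OF restrict_rest_permutes[OF assms]] by simp
    then have "cycle_of_list (i # l) (restrict_rest \<sigma> x) = restrict_rest \<sigma> x"
      by (intro cycle_fix) (auto simp: rest_eq)
    with 2 show ?thesis by (simp add: add_cycle_def restrict_rest_def)
  next
    case 3
    then have "x \<notin> rest" "\<sigma> x = x" "x \<notin> set (i # l)"
      using with_cycle_support(3)[OF assms] sub by (auto simp: rest_eq permutes_def)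
    then show ?thesis using cycle_fix[of x] by (simp add: add_cycle_def restrict_rest_def)
  qed
qed

lemma restrict_rest_add_cycle:
  assumes "\<sigma> permutes rest"
  shows "restrict_rest (add_cycle \<sigma>) = \<sigma>"
proof
  fix x show "restrict_rest (add_cycle \<sigma>) x = \<sigma> x"
  proof (cases "x \<in> rest")
    case True
    then have "\<sigma> x \<notin> set (i # l)" using permutes_in_image[OF assms] by (auto simp: rest_eq)
    with True show ?thesis using cycle_fix by (simp add: restrict_rest_def add_cycle_def)
  next
    case False
    with assms show ?thesis by (simp add: restrict_rest_def permutes_def)
  qed
qed

lemma add_cycle_in_with_cycle:
  assumes "\<sigma> permutes rest"
  shows "add_cycle \<sigma> \<in> with_cycle"
proof -
  have "\<sigma> permutes \<alpha>" using assms by (rule permutes_subset) (auto simp: rest_eq)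
  moreover have "cycle_of_list (i # l) permutes \<alpha>"
    using cycle_permutes sub by (rule permutes_subset)
  ultimately have "add_cycle \<sigma> permutes \<alpha>" unfolding add_cycle_def by (rule permutes_compose)
  moreover have "add_cycle \<sigma> x = cycle_of_list (i # l) x" if "x \<in> set (i # l)" for x
    using permutes_not_in[OF assms, of x] that by (simp only: add_cycle_def rest_eq o_apply Diff_iff simp_thms)
  then have "map (add_cycle \<sigma>) (i # l) = map (cycle_of_list (i # l)) (i # l)"
    by (intro map_cong refl)
  ultimately show ?thesis unfolding with_cycle_def mem_Collect_eq map_cycle by (rule conjI)
qed

lemma funpow_restrict_rest:
  assumes "\<sigma> \<in> with_cycle" "s \<in> rest"
  shows "(restrict_rest \<sigma> ^^ k) s = (\<sigma> ^^ k) s"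
proof (induction k)
  case (Suc k)
  have "(restrict_rest \<sigma> ^^ k) s \<in> rest"
    using permutes_in_image[OF permutes_funpow[OF restrict_rest_permutes[OF assms(1)]]] assms(2)
    by simp
  with Suc show ?case by (simp add: restrict_rest_def)
qed simp

lemma support_restrict_rest:
  assumes "\<sigma> \<in> with_cycle" "s \<in> rest"
  shows "support (restrict_rest \<sigma>) s = support \<sigma> s"
  using funpow_restrict_rest[OF assms] by (simp add: least_power_def)

lemma cycle_prod_restrict_rest:
  assumes "\<sigma> \<in> with_cycle" "s \<in> rest"
  shows "cycle_prod B (restrict_rest \<sigma>) s = cycle_prod B \<sigma> s"
proof -
  have "set (support \<sigma> s) \<subseteq> rest"
    using support_subset[OF restrict_rest_permutes[OF assms(1)] assms(2)]
    unfolding support_restrict_rest[OF assms] .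
  then have "map (\<lambda>t. B $$ (t, restrict_rest \<sigma> t)) (support \<sigma> s)
      = map (\<lambda>t. B $$ (t, \<sigma> t)) (support \<sigma> s)"
    by (intro map_cong refl) (simp add: restrict_rest_def subset_iff)
  then show ?thesis unfolding cycle_prod_def support_restrict_rest[OF assms] by (rule arg_cong)
qed

text \<open>Not meeting the cycle of \<open>i\<close> means lying in \<open>rest\<close>, and
  restriction leaves the other cycles, hence their least elements, unchanged.\<close>

lemma cycle_heads_with_cycle:
  assumes "\<sigma> \<in> with_cycle"
  shows "cycle_heads \<alpha> i \<sigma> = i # least_cycle_heads rest (restrict_rest \<sigma>)"
proof -
  note sup = with_cycle_support[OF assms]
  have key: "i \<notin> set (support \<sigma> s) \<longleftrightarrow> s \<in> rest" if "s \<in> \<alpha>" for s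
  proof -
    have "i \<notin> set (support \<sigma> s) \<longleftrightarrow> s \<notin> set (support \<sigma> i)"
      using disjoint_support'[OF sup(2), of i s] disjoint_support'[OF sup(2), of s i] by blast
    also have "\<dots> \<longleftrightarrow> s \<in> rest" unfolding sup(1) using that by (simp add: rest_eq)
    finally show ?thesis .
  qed
  have "{s \<in> \<alpha>. i \<notin> set (support \<sigma> s) \<and> (\<forall>t \<in> set (support \<sigma> s). s \<le> t)} =
     {s \<in> rest. \<forall>t \<in> set (support (restrict_rest \<sigma>) s). s \<le> t}" (is "?L = ?R")
  proof (intro Collect_cong iffI conjI)
    fix s assume s: "s \<in> \<alpha> \<and> i \<notin> set (support \<sigma> s) \<and> (\<forall>t \<in> set (support \<sigma> s). s \<le> t)"
    then show 1: "s \<in> rest" using key by blast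
    from s show "\<forall>t \<in> set (support (restrict_rest \<sigma>) s). s \<le> t"
      unfolding support_restrict_rest[OF assms 1] by blast
  next
    fix s assume s: "s \<in> rest \<and> (\<forall>t \<in> set (support (restrict_rest \<sigma>) s). s \<le> t)"
    then show 1: "s \<in> \<alpha>" by (simp add: rest_eq)
    show "i \<notin> set (support \<sigma> s)" using key[OF 1] s by blast
    from s show "\<forall>t \<in> set (support \<sigma> s). s \<le> t"
      using support_restrict_rest[OF assms, of s] by metis
  qed
  then show ?thesis by (simp only: cycle_heads_def least_cycle_heads_def)
qed

lemma map_cycle_prod_with_cycle:
  assumes "\<sigma> \<in> with_cycle"
  shows "map (cycle_prod B \<sigma>) (cycle_heads \<alpha> i \<sigma>) = path_prod B (i # l @ [i]) #
     map (cycle_prod B (restrict_rest \<sigma>)) (least_cycle_heads rest (restrict_rest \<sigma>))"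
proof -
  have "cycle_prod B \<sigma> i = path_prod B (i # l @ [i])"
    unfolding cycle_prod_def with_cycle_support(1)[OF assms]
    using assms by (intro prod_list_entries_eq_path_prod) (simp add: with_cycle_def)
  moreover have "set (least_cycle_heads rest (restrict_rest \<sigma>)) \<subseteq> rest"
    using fin by (auto simp: least_cycle_heads_def rest_eq)
  ultimately show ?thesis
    unfolding cycle_heads_with_cycle[OF assms]
    by (auto simp: cycle_prod_restrict_rest[OF assms])
qed

lemma sum_with_cycle:
  "(\<Sum>\<sigma>\<in>with_cycle. F (map (cycle_prod B \<sigma>) (cycle_heads \<alpha> i \<sigma>))) =
   (\<Sum>\<sigma> | \<sigma> permutes rest.
      F (path_prod B (i # l @ [i]) # map (cycle_prod B \<sigma>) (least_cycle_heads rest \<sigma>)))"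
  by (rule sum.reindex_bij_witness[of _ add_cycle restrict_rest])
     (auto simp: restrict_rest_permutes add_cycle_restrict_rest restrict_rest_add_cycle
        add_cycle_in_with_cycle map_cycle_prod_with_cycle)

end

text \<open>Permutations are grouped by the list that follows \<open>i\<close> in its cycle.
  \<open>F\<close> is an arbitrary function of the list of cycle words: its length determines the
  sign and its order distinguishes \<open>rdet\<close> from \<open>cdet\<close>, so both are
  instances.\<close>

lemma sum_permutes_split_cycle:
  assumes "finite \<alpha>" "i \<in> \<alpha>"
  shows "(\<Sum>\<sigma> | \<sigma> permutes \<alpha>. F (map (cycle_prod B \<sigma>) (cycle_heads \<alpha> i \<sigma>))) =
    (\<Sum>l\<in>distinct_lists (\<alpha> - {i}). \<Sum>\<sigma> | \<sigma> permutes (\<alpha> - {i} - set l).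
      F (path_prod B (i # l @ [i]) #
         map (cycle_prod B \<sigma>) (least_cycle_heads (\<alpha> - {i} - set l) \<sigma>)))"
proof -
  let ?g = "\<lambda>\<sigma>. tl (support \<sigma> i)"
  have perm: "permutation \<sigma>" if "\<sigma> permutes \<alpha>" for \<sigma>
    using that assms(1) by (auto simp: permutation_permutes)
  have g: "?g ` {\<sigma>. \<sigma> permutes \<alpha>} \<subseteq> distinct_lists (\<alpha> - {i})"
  proof clarify
    fix \<sigma> assume s: "\<sigma> permutes \<alpha>"
    have "distinct (i # ?g \<sigma>)" "set (i # ?g \<sigma>) \<subseteq> \<alpha>"
      using cycle_of_permutation[OF perm[OF s], of i] support_subset[OF s assms(2)]
      unfolding support_Cons(1)[OF perm[OF s], of i, symmetric] by blast+
    then show "?g \<sigma> \<in> distinct_lists (\<alpha> - {i})" by (auto simp: distinct_lists_def)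
  qed
  have eq: "{\<sigma> \<in> {\<sigma>. \<sigma> permutes \<alpha>}. ?g \<sigma> = l} = split_cycle.with_cycle \<alpha> i l"
    if l: "l \<in> distinct_lists (\<alpha> - {i})" for l
  proof -
    interpret split_cycle \<alpha> i l by unfold_locales (use assms l in auto)
    show ?thesis
    proof (intro equalityI subsetI)
      fix \<sigma> assume "\<sigma> \<in> {\<sigma> \<in> {\<sigma>. \<sigma> permutes \<alpha>}. ?g \<sigma> = l}"
      then have s: "\<sigma> permutes \<alpha>" "?g \<sigma> = l" by blast+
      then have "support \<sigma> i = i # l" using support_Cons(1)[OF perm[OF s(1)], of i] by metis
      with support_eq_iff[OF perm[OF s(1)] dist] have "map \<sigma> (i # l) = l @ [i]" by (rule iffD1)
      with s(1) show "\<sigma> \<in> with_cycle" unfolding with_cycle_def by blast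
    next
      fix \<sigma> assume "\<sigma> \<in> with_cycle"
      then show "\<sigma> \<in> {\<sigma> \<in> {\<sigma>. \<sigma> permutes \<alpha>}. ?g \<sigma> = l}"
        using with_cycle_support[of \<sigma>] by (metis (mono_tags, lifting) list.sel(3) mem_Collect_eq)
    qed
  qed
  have fin: "finite {\<sigma>. \<sigma> permutes \<alpha>}" using assms(1) by (rule finite_permutations)
  have "(\<Sum>\<sigma> | \<sigma> permutes \<alpha>. F (map (cycle_prod B \<sigma>) (cycle_heads \<alpha> i \<sigma>))) =
    (\<Sum>l\<in>distinct_lists (\<alpha> - {i}). \<Sum>\<sigma>\<in>{\<sigma> \<in> {\<sigma>. \<sigma> permutes \<alpha>}. ?g \<sigma> = l}.
       F (map (cycle_prod B \<sigma>) (cycle_heads \<alpha> i \<sigma>)))"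
    by (rule sum.group[OF fin _ g, symmetric]) (use assms in simp)
  also have "\<dots> = (\<Sum>l\<in>distinct_lists (\<alpha> - {i}). \<Sum>\<sigma> | \<sigma> permutes (\<alpha> - {i} - set l).
      F (path_prod B (i # l @ [i]) #
         map (cycle_prod B \<sigma>) (least_cycle_heads (\<alpha> - {i} - set l) \<sigma>)))"
  proof (rule sum.cong[OF refl])
    fix l assume l: "l \<in> distinct_lists (\<alpha> - {i})"
    then interpret split_cycle \<alpha> i l by unfold_locales (use assms in auto)
    show "(\<Sum>\<sigma>\<in>{\<sigma> \<in> {\<sigma>. \<sigma> permutes \<alpha>}. ?g \<sigma> = l}.
        F (map (cycle_prod B \<sigma>) (cycle_heads \<alpha> i \<sigma>))) =
      (\<Sum>\<sigma> | \<sigma> permutes (\<alpha> - {i} - set l). F (path_prod B (i # l @ [i]) #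
         map (cycle_prod B \<sigma>) (least_cycle_heads (\<alpha> - {i} - set l) \<sigma>)))"
      unfolding eq[OF l] sum_with_cycle rest_def by (rule refl)
  qed
  finally show ?thesis .
qed

section \<open>Expansion of the row and column determinants along a cycle\<close>

text \<open>On the empty index set \<^const>\<open>rdet\<close> and \<^const>\<open>cdet\<close> are junk; the value 1 continues the
  cycle expansions below to this case.\<close>

definition rdet_min :: "quat mat \<Rightarrow> nat set \<Rightarrow> quat" where
  "rdet_min B \<gamma> = (if \<gamma> = {} then 1 else rdet \<gamma> (Min \<gamma>) B)"

definition cdet_min :: "quat mat \<Rightarrow> nat set \<Rightarrow> quat" where
  "cdet_min B \<gamma> = (if \<gamma> = {} then 1 else cdet \<gamma> (Min \<gamma>) B)"

lemma permutes_empty_Collect: "{\<sigma>. \<sigma> permutes {}} = {id}"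
  by auto

lemma rdet_min_eq:
  assumes "finite \<gamma>"
  shows "rdet_min B \<gamma> = (\<Sum>\<sigma> | \<sigma> permutes \<gamma>.
    (- 1) ^ (card \<gamma> - length (least_cycle_heads \<gamma> \<sigma>)) *
    prod_list (map (cycle_prod B \<sigma>) (least_cycle_heads \<gamma> \<sigma>)))"
proof (cases "\<gamma> = {}")
  \<comment> \<open>The empty set has only the permutation \<open>id\<close>, with no heads and an
    empty product.\<close>
  case True
  then show ?thesis by (simp add: rdet_min_def permutes_empty_Collect least_cycle_heads_def)
next
  case False
  then show ?thesis using assms
    by (simp add: rdet_min_def rdet_def cycle_heads_Min cong: sum.cong_simp)
qed

lemma cdet_min_eq:
  assumes "finite \<gamma>"
  shows "cdet_min B \<gamma> = (\<Sum>\<sigma> | \<sigma> permutes \<gamma>.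
    (- 1) ^ (card \<gamma> - length (least_cycle_heads \<gamma> \<sigma>)) *
    prod_list (map (cycle_prod B \<sigma>) (rev (least_cycle_heads \<gamma> \<sigma>))))"
proof (cases "\<gamma> = {}")
  case True
  then show ?thesis by (simp add: cdet_min_def permutes_empty_Collect least_cycle_heads_def)
next
  case False
  then show ?thesis using assms
    by (simp add: cdet_min_def cdet_def cycle_heads_Min cong: sum.cong_simp)
qed

lemma card_minus_cycle:
  assumes "finite \<alpha>" "i \<in> \<alpha>" "l \<in> distinct_lists (\<alpha> - {i})"
  shows "card \<alpha> = Suc (length l + card (\<alpha> - {i} - set l))"
proof -
  have "card (\<alpha> - {i}) = length l + card (\<alpha> - {i} - set l)"
  proof -
    have "set l \<subseteq> \<alpha> - {i}" "card (set l) = length l"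
      using assms(3) by (auto simp: distinct_lists_def distinct_card)
    then show ?thesis
      using assms(1) card_mono[of "\<alpha> - {i}" "set l"] by (simp add: card_Diff_subset)
  qed
  then show ?thesis using assms by (metis card_Suc_Diff1)
qed

text \<open>Removing the cycle of \<open>i\<close> takes away \<open>length l + 1\<close> indices
  and one cycle, so the exponent drops by \<open>length l\<close>. The bound on the number of heads
  keeps the natural subtraction exact.\<close>

lemma sign_minus_cycle:
  assumes "finite \<alpha>" "i \<in> \<alpha>" "l \<in> distinct_lists (\<alpha> - {i})"
  shows "(- 1 :: quat) ^ (card \<alpha> - Suc (length (least_cycle_heads (\<alpha> - {i} - set l) \<sigma>))) =
    (- 1) ^ length l *
    (- 1) ^ (card (\<alpha> - {i} - set l) - length (least_cycle_heads (\<alpha> - {i} - set l) \<sigma>))"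
  using length_least_cycle_heads[of "\<alpha> - {i} - set l" \<sigma>] assms(1)
  by (simp add: card_minus_cycle[OF assms] power_add[symmetric])

text \<open>The word of the cycle through \<open>i\<close> stands leftmost in every term and factors
  out; the remaining cycles are ordered by their minima, as in a determinant headed by its
  minimum.\<close>

lemma rdet_cycle_expansion:
  assumes "finite \<alpha>" "i \<in> \<alpha>"
  shows "rdet \<alpha> i B = (\<Sum>l\<in>distinct_lists (\<alpha> - {i}).
    (- 1) ^ length l * (path_prod B (i # l @ [i]) * rdet_min B (\<alpha> - {i} - set l)))"
proof -
  let ?F = "\<lambda>xs. (- 1 :: quat) ^ (card \<alpha> - length xs) * prod_list xs"
  have "rdet \<alpha> i B = (\<Sum>\<sigma> | \<sigma> permutes \<alpha>. ?F (map (cycle_prod B \<sigma>) (cycle_heads \<alpha> i \<sigma>)))"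
    by (simp add: rdet_def)
  also have "\<dots> = (\<Sum>l\<in>distinct_lists (\<alpha> - {i}).
    (- 1) ^ length l * (path_prod B (i # l @ [i]) * rdet_min B (\<alpha> - {i} - set l)))"
    unfolding sum_permutes_split_cycle[OF assms, of ?F B]
  proof (rule sum.cong[OF refl])
    fix l assume l: "l \<in> distinct_lists (\<alpha> - {i})"
    have fin: "finite (\<alpha> - {i} - set l)" using assms by simp
    show "(\<Sum>\<sigma> | \<sigma> permutes (\<alpha> - {i} - set l). ?F (path_prod B (i # l @ [i]) #
         map (cycle_prod B \<sigma>) (least_cycle_heads (\<alpha> - {i} - set l) \<sigma>))) =
      (- 1) ^ length l * (path_prod B (i # l @ [i]) * rdet_min B (\<alpha> - {i} - set l))"
      unfolding rdet_min_eq[OF fin] sum_distrib_left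
      by (intro sum.cong refl)
        (simp only: list.size length_map add_0_right add_Suc_right One_nat_def sign_minus_cycle[OF assms l]
           prod_list.Cons sign_inner_commute)
  qed
  finally show ?thesis .
qed

text \<open>The reversed order of cycles puts the word through \<open>i\<close> at the right
  end.\<close>

lemma cdet_cycle_expansion:
  assumes "finite \<alpha>" "i \<in> \<alpha>"
  shows "cdet \<alpha> i B = (\<Sum>l\<in>distinct_lists (\<alpha> - {i}).
    (- 1) ^ length l * (cdet_min B (\<alpha> - {i} - set l) * path_prod B (i # l @ [i])))"
proof -
  let ?F = "\<lambda>xs. (- 1 :: quat) ^ (card \<alpha> - length xs) * prod_list (rev xs)"
  have "cdet \<alpha> i B = (\<Sum>\<sigma> | \<sigma> permutes \<alpha>. ?F (map (cycle_prod B \<sigma>) (cycle_heads \<alpha> i \<sigma>)))"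
    by (simp add: cdet_def rev_map)
  also have "\<dots> = (\<Sum>l\<in>distinct_lists (\<alpha> - {i}).
    (- 1) ^ length l * (cdet_min B (\<alpha> - {i} - set l) * path_prod B (i # l @ [i])))"
    unfolding sum_permutes_split_cycle[OF assms, of ?F B]
  proof (rule sum.cong[OF refl])
    fix l assume l: "l \<in> distinct_lists (\<alpha> - {i})"
    have fin: "finite (\<alpha> - {i} - set l)" using assms by simp
    show "(\<Sum>\<sigma> | \<sigma> permutes (\<alpha> - {i} - set l). ?F (path_prod B (i # l @ [i]) #
         map (cycle_prod B \<sigma>) (least_cycle_heads (\<alpha> - {i} - set l) \<sigma>))) =
      (- 1) ^ length l * (cdet_min B (\<alpha> - {i} - set l) * path_prod B (i # l @ [i]))"
      unfolding cdet_min_eq[OF fin] sum_distrib_left sum_distrib_right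
      by (intro sum.cong refl)
        (simp only: list.size length_map add_0_right add_Suc_right One_nat_def sign_minus_cycle[OF assms l],
         simp add: rev_map mult.assoc)
  qed
  finally show ?thesis .
qed

text \<open>Conjugation reverses both the words and the order of the cycles, which exchanges the two
  cycle expansions. The induction treats the complement of a cycle, and reversal of lists permutes
  the summands. The row formula will follow from the column formula in this way.\<close>

lemma adjoint_dets:
  assumes "finite \<gamma>"
    and "\<And>x y. x \<in> \<gamma> \<Longrightarrow> y \<in> \<gamma> \<Longrightarrow> C $$ (y, x) = qcnj (B $$ (x, y))"
  shows "cdet_min C \<gamma> = qcnj (rdet_min B \<gamma>) \<and> (\<forall>i\<in>\<gamma>. cdet \<gamma> i C = qcnj (rdet \<gamma> i B))"
  using assms
proof (induction \<gamma> rule: finite_psubset_induct)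
  case (psubset \<gamma>)
  have *: "cdet \<gamma> i C = qcnj (rdet \<gamma> i B)" if i: "i \<in> \<gamma>" for i
  proof -
    have "qcnj (rdet \<gamma> i B) = (\<Sum>l\<in>distinct_lists (\<gamma> - {i}). (- 1) ^ length l *
        (cdet_min C (\<gamma> - {i} - set l) * path_prod C (i # rev l @ [i])))"
      unfolding rdet_cycle_expansion[OF psubset(1) i] qcnj_sum
    proof (rule sum.cong[OF refl])
      fix l assume l: "l \<in> distinct_lists (\<gamma> - {i})"
      have "path_prod C (rev (i # l @ [i])) = qcnj (path_prod B (i # l @ [i]))"
        using distinct_listsD[OF l] i by (intro path_prod_rev psubset.prems) auto
      moreover have "cdet_min C (\<gamma> - {i} - set l) = qcnj (rdet_min B (\<gamma> - {i} - set l))"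
        using i by (intro psubset.IH[THEN conjunct1] psubset.prems) auto
      ultimately show "qcnj ((- 1) ^ length l *
          (path_prod B (i # l @ [i]) * rdet_min B (\<gamma> - {i} - set l))) =
        (- 1) ^ length l * (cdet_min C (\<gamma> - {i} - set l) * path_prod C (i # rev l @ [i]))"
        by (simp add: sign_commute[symmetric])
    qed
    also have "\<dots> = cdet \<gamma> i C"
      unfolding cdet_cycle_expansion[OF psubset(1) i]
      by (subst sum_distinct_lists_rev[symmetric]) simp
    finally show ?thesis by simp
  qed
  then show ?case using psubset(1) by (auto simp: rdet_min_def cdet_min_def)
qed

lemma cdet_min_cong:
  assumes "finite \<gamma>"
    and "\<And>x y. x \<in> \<gamma> \<Longrightarrow> y \<in> \<gamma> \<Longrightarrow> B $$ (x, y) = C $$ (x, y)"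
  shows "cdet_min B \<gamma> = cdet_min C \<gamma>"
proof -
  have "cycle_prod B \<sigma> s = cycle_prod C \<sigma> s" if "\<sigma> permutes \<gamma>" "s \<in> \<gamma>" for \<sigma> s
  proof -
    have "map (\<lambda>t. B $$ (t, \<sigma> t)) (support \<sigma> s) = map (\<lambda>t. C $$ (t, \<sigma> t)) (support \<sigma> s)"
      using support_subset[OF that] permutes_in_image[OF that(1)]
      by (intro map_cong refl assms(2)) blast+
    then show ?thesis unfolding cycle_prod_def by (rule arg_cong)
  qed
  then show ?thesis
    unfolding cdet_min_eq[OF assms(1)]
    by (intro sum.cong refl arg_cong2[where f = "(*)"] arg_cong[where f = prod_list] map_cong)
      (use assms(1) in \<open>auto simp: least_cycle_heads_def\<close>)
qed

section \<open>Principal minors of Hermitian matrices\<close>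

definition hermitian_on :: "nat set \<Rightarrow> quat mat \<Rightarrow> bool" where
  "hermitian_on \<gamma> B \<longleftrightarrow> (\<forall>x\<in>\<gamma>. \<forall>y\<in>\<gamma>. B $$ (y, x) = qcnj (B $$ (x, y)))"

lemma hermitian_on_subset: "hermitian_on \<gamma> B \<Longrightarrow> \<delta> \<subseteq> \<gamma> \<Longrightarrow> hermitian_on \<delta> B"
  by (auto simp: hermitian_on_def)

text \<open>Taking the real part loses nothing for Hermitian matrices, by
  \<open>hermitian_dets\<close>, and makes the minors central from the outset.\<close>

definition minor :: "quat mat \<Rightarrow> nat set \<Rightarrow> real" where
  "minor B \<gamma> = qre (rdet_min B \<gamma>)"

lemma minor_empty [simp]: "minor B {} = 1"
  by (simp add: minor_def rdet_min_def)

text \<open>The candidate value of the determinant along \<open>i\<close>, with only the real part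
  of each cycle word through \<open>i\<close>.\<close>

definition minor_expansion :: "quat mat \<Rightarrow> nat set \<Rightarrow> nat \<Rightarrow> real" where
  "minor_expansion B \<gamma> i = (\<Sum>l\<in>distinct_lists (\<gamma> - {i}).
     (- 1) ^ length l * (qre (path_prod B (i # l @ [i])) * minor B (\<gamma> - {i} - set l)))"

text \<open>Conjugation reverses the cycle through \<open>i\<close>, so only its real part survives the sum.\<close>

lemma hermitian_cycle_sum_real:
  assumes "finite \<gamma>" "i \<in> \<gamma>" "hermitian_on \<gamma> B"
  shows "(\<Sum>l\<in>distinct_lists (\<gamma> - {i}). (- 1) ^ length l *
      (path_prod B (i # l @ [i]) * quat_of_real (minor B (\<gamma> - {i} - set l)))) =
    quat_of_real (minor_expansion B \<gamma> i)" (is "?F = _")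
proof -
  have "qcnj ?F = (\<Sum>l\<in>distinct_lists (\<gamma> - {i}). (- 1) ^ length (rev l) *
      (path_prod B (i # rev l @ [i]) * quat_of_real (minor B (\<gamma> - {i} - set (rev l)))))"
    unfolding qcnj_sum
  proof (rule sum.cong[OF refl])
    fix l assume l: "l \<in> distinct_lists (\<gamma> - {i})"
    have "path_prod B (rev (i # l @ [i])) = qcnj (path_prod B (i # l @ [i]))"
      using distinct_listsD[OF l] assms(2,3) by (intro path_prod_rev) (auto simp: hermitian_on_def)
    then show "qcnj ((- 1) ^ length l *
        (path_prod B (i # l @ [i]) * quat_of_real (minor B (\<gamma> - {i} - set l)))) =
      (- 1) ^ length (rev l) *
        (path_prod B (i # rev l @ [i]) * quat_of_real (minor B (\<gamma> - {i} - set (rev l))))"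
      by (simp add: sign_commute[symmetric] quat_of_real_commute)
  qed
  also have "\<dots> = ?F" by (rule sum_distinct_lists_rev)
  finally have "?F = quat_of_real (qre ?F)" by (simp only: qcnj_fixed_iff)
  moreover have "qre ((- 1) ^ k * (x * quat_of_real t)) = (- 1) ^ k * (qre x * t)" for k x t
    by (cases "even k") (simp_all add: quat_times_components)
  then have "qre ?F = minor_expansion B \<gamma> i"
    unfolding minor_expansion_def qre_sum by (intro sum.cong refl) simp
  ultimately show ?thesis by simp
qed

text \<open>Expand along \<open>i\<close>. If the cycle of \<open>i\<close> misses \<open>j\<close>,
  expand the complementary minor along \<open>j\<close>; otherwise cut the cycle at \<open>j\<close>
  into two paths. Both resulting double sums are symmetric in \<open>i\<close> and
  \<open>j\<close>.\<close>

lemma minor_expansion_independent: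
  assumes fin: "finite \<gamma>" and ij: "i \<in> \<gamma>" "j \<in> \<gamma>"
    and IH: "\<And>\<delta> k. \<delta> \<subset> \<gamma> \<Longrightarrow> k \<in> \<delta> \<Longrightarrow> minor B \<delta> = minor_expansion B \<delta> k"
  shows "minor_expansion B \<gamma> i = minor_expansion B \<gamma> j"
proof (cases "i = j")
  case False
  \<comment> \<open>\<open>?f\<close> weighs two disjoint cycles through \<open>i\<close> and
    \<open>j\<close>; \<open>?g\<close> weighs one cycle through both, where \<open>Suc\<close>
    counts \<open>j\<close> as an interior vertex.\<close>
  let ?f = "\<lambda>i j u v. (- 1) ^ (length u + length v) *
     (qre (path_prod B (i # u @ [i])) * qre (path_prod B (j # v @ [j])) *
        minor B (\<gamma> - {i, j} - set u - set v))"
  let ?g = "\<lambda>i j u v. (- 1) ^ Suc (length u + length v) *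
     (qre (path_prod B (i # u @ [j]) * path_prod B (j # v @ [i])) *
        minor B (\<gamma> - {i, j} - set u - set v))"
  have split: "minor_expansion B \<gamma> i =
    (\<Sum>u\<in>distinct_lists (\<gamma> - {i, j}). \<Sum>v\<in>distinct_lists (\<gamma> - {i, j} - set u). ?f i j u v) +
    (\<Sum>u\<in>distinct_lists (\<gamma> - {i, j}). \<Sum>v\<in>distinct_lists (\<gamma> - {i, j} - set u). ?g i j u v)"
    if ij: "i \<in> \<gamma>" "j \<in> \<gamma>" "i \<noteq> j" for i j
  proof -
    have ins: "\<gamma> - {i} = insert j (\<gamma> - {i, j})" using ij by auto
    have 1: "(- 1) ^ length u * (qre (path_prod B (i # u @ [i])) *
        minor B (insert j (\<gamma> - {i, j}) - set u)) =
      (\<Sum>v\<in>distinct_lists (\<gamma> - {i, j} - set u). ?f i j u v)"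
      if u: "u \<in> distinct_lists (\<gamma> - {i, j})" for u
    proof -
      have ju: "j \<notin> set u" using u by (auto simp: distinct_lists_def)
      have e: "insert j (\<gamma> - {i, j}) - set u - {j} = \<gamma> - {i, j} - set u" using ju by auto
      have "minor B (insert j (\<gamma> - {i, j}) - set u) =
          minor_expansion B (insert j (\<gamma> - {i, j}) - set u) j"
        using ij ju by (intro IH) auto
      then show ?thesis
        unfolding minor_expansion_def e by (simp add: sum_distrib_left power_add mult_ac)
    qed
    have 2: "(- 1) ^ length (u @ j # v) * (qre (path_prod B (i # (u @ j # v) @ [i])) *
        minor B (insert j (\<gamma> - {i, j}) - set (u @ j # v))) = ?g i j u v"
      if "u \<in> distinct_lists (\<gamma> - {i, j})" "v \<in> distinct_lists (\<gamma> - {i, j} - set u)" for u v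
    proof -
      have "path_prod B (i # (u @ j # v) @ [i]) = path_prod B (i # u @ [j]) * path_prod B (j # v @ [i])"
        using path_prod_append[of B "i # u" j "v @ [i]"] by simp
      moreover have "insert j (\<gamma> - {i, j}) - set (u @ j # v) = \<gamma> - {i, j} - set u - set v" by auto
      ultimately show ?thesis by simp
    qed
    show ?thesis
      unfolding minor_expansion_def ins
      by (subst sum_distinct_lists_split) (use fin in \<open>simp_all only: 1 2 cong: sum.cong, auto\<close>)
  qed
  \<comment> \<open>For \<open>?f\<close> real numbers commute; for \<open>?g\<close> the real part
    of a product does not change when the two paths trade places.\<close>
  have f: "?f j i u v = ?f i j v u" and g: "?g j i u v = ?g i j v u" for u v
    using qre_commute[of "path_prod B (j # u @ [i])" "path_prod B (i # v @ [j])"]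
    by (simp_all add: insert_commute Diff_Diff_Int Un_commute Diff_eq Int_ac add.commute mult_ac)
  show ?thesis
    unfolding split[OF ij False] split[OF ij(2,1) not_sym[OF False]] f g
    unfolding insert_commute[of j i]
    by (intro arg_cong2[where f = "(+)"]; subst sum_distinct_lists_swap) (use fin in auto)
qed simp

text \<open>By induction the complementary minors are real, so
  \<open>hermitian_cycle_sum_real\<close> evaluates every row and column determinant as
  \<open>minor_expansion\<close>. The index \<open>Min \<gamma>\<close> ties this value to
  \<open>minor\<close>, and independence of the index does the rest.\<close>

theorem hermitian_dets:
  assumes "finite \<gamma>" "hermitian_on \<gamma> B"
  shows "rdet_min B \<gamma> = quat_of_real (minor B \<gamma>) \<and> cdet_min B \<gamma> = quat_of_real (minor B \<gamma>) \<and>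
    (\<forall>i\<in>\<gamma>. rdet \<gamma> i B = quat_of_real (minor B \<gamma>) \<and> cdet \<gamma> i B = quat_of_real (minor B \<gamma>) \<and>
       minor B \<gamma> = minor_expansion B \<gamma> i)"
  using assms
proof (induction \<gamma> rule: finite_psubset_induct)
  case (psubset \<gamma>)
  have IH: "rdet_min B \<delta> = quat_of_real (minor B \<delta>)" "cdet_min B \<delta> = quat_of_real (minor B \<delta>)"
    "\<And>k. k \<in> \<delta> \<Longrightarrow> minor B \<delta> = minor_expansion B \<delta> k"
    if "\<delta> \<subset> \<gamma>" for \<delta>
    using psubset.IH[OF that] hermitian_on_subset[OF psubset.prems, of \<delta>] that by auto
  have r: "rdet \<gamma> i B = quat_of_real (minor_expansion B \<gamma> i)" 
    and c: "cdet \<gamma> i B = quat_of_real (minor_expansion B \<gamma> i)" if i: "i \<in> \<gamma>" for i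
  proof -
    have "\<gamma> - {i} - set l \<subset> \<gamma>" for l using i by auto
    note IH = IH(1,2)[OF this]
    show "rdet \<gamma> i B = quat_of_real (minor_expansion B \<gamma> i)"
      unfolding rdet_cycle_expansion[OF psubset(1) i] IH
      by (rule hermitian_cycle_sum_real[OF psubset(1) i psubset.prems])
    show "cdet \<gamma> i B = quat_of_real (minor_expansion B \<gamma> i)"
      unfolding cdet_cycle_expansion[OF psubset(1) i] IH quat_of_real_commute
      by (rule hermitian_cycle_sum_real[OF psubset(1) i psubset.prems])
  qed
  show ?case
  proof (cases "\<gamma> = {}")
    case True
    then show ?thesis by (simp add: rdet_min_def cdet_min_def)
  next
    case False
    then have m: "Min \<gamma> \<in> \<gamma>" using psubset(1) by simp
    have "minor B \<gamma> = minor_expansion B \<gamma> (Min \<gamma>)"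
      using False r[OF m] by (simp add: minor_def rdet_min_def)
    then have e: "minor B \<gamma> = minor_expansion B \<gamma> i" if "i \<in> \<gamma>" for i
      using minor_expansion_independent[OF psubset(1) m that, of B] IH(3) by simp
    have "rdet_min B \<gamma> = quat_of_real (minor B \<gamma>)" "cdet_min B \<gamma> = quat_of_real (minor B \<gamma>)"
      using False r[OF m] c[OF m] e[OF m] by (simp_all add: rdet_min_def cdet_min_def)
    with r c e show ?thesis by metis
  qed
qed

lemma hdet_eq_minor:
  assumes "finite \<gamma>" "\<gamma> \<noteq> {}" "hermitian_on \<gamma> B"
  shows "hdet \<gamma> B = quat_of_real (minor B \<gamma>)"
  unfolding hdet_def
  using hermitian_dets[OF assms(1,3)] assms(2) by (intro the_equality) auto

lemma minor_eq_expansion: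
  assumes "finite \<gamma>" "hermitian_on \<gamma> B" "i \<in> \<gamma>"
  shows "quat_of_real (minor B \<gamma>) = (\<Sum>l\<in>distinct_lists (\<gamma> - {i}). (- 1) ^ length l *
      (path_prod B (i # l @ [i]) * quat_of_real (minor B (\<gamma> - {i} - set l))))"
  using hermitian_dets[OF assms(1,2)] assms(3) hermitian_cycle_sum_real[OF assms(1,3,2)] by metis

section \<open>Cramer's rule for principal submatrices\<close>

text \<open>The cofactor expansion of the column determinant with column \<open>i\<close> replaced
  by \<open>c\<close>: a simple path leads from \<open>i\<close> to the row whose entry of
  \<open>c\<close> closes the word. A function in place of a vector makes linearity easy to
  state.\<close>

definition cramer_sum :: "quat mat \<Rightarrow> nat set \<Rightarrow> nat \<Rightarrow> (nat \<Rightarrow> quat) \<Rightarrow> quat" where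
  "cramer_sum B \<beta> i c = (\<Sum>l\<in>distinct_lists (\<beta> - {i}). (- 1) ^ length l *
     (quat_of_real (minor B (\<beta> - {i} - set l)) * path_prod B (i # l)) * c (last (i # l)))"

text \<open>Right linearity holds because the entry of the column ends each word.\<close>

lemma cramer_sum_sum:
  "cramer_sum B \<beta> i (\<lambda>k. \<Sum>t\<in>S. c t k * f t) = (\<Sum>t\<in>S. cramer_sum B \<beta> i (c t) * f t)"
  unfolding cramer_sum_def sum_distrib_left sum_distrib_right
  by (subst sum.swap) (simp add: mult.assoc)

lemma last_path_in:
  assumes "i \<in> \<beta>" "l \<in> distinct_lists (\<beta> - {i})"
  shows "last (i # l) \<in> \<beta>"
  using assms distinct_listsD[OF assms(2)] by (metis insert_subset last_in_set list.discI list.simps(15) subset_iff)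

lemma cramer_sum_cong:
  assumes "i \<in> \<beta>" "\<And>k. k \<in> \<beta> \<Longrightarrow> c k = d k"
  shows "cramer_sum B \<beta> i c = cramer_sum B \<beta> i d"
  unfolding cramer_sum_def using assms(2)[OF last_path_in[OF assms(1)]] by (intro sum.cong refl) simp

text \<open>Only the closing edge of the cycle through \<open>i\<close> lies in column
  \<open>i\<close>. The rest of the word and the complementary minor see \<open>B\<close> alone, so
  these minors are real although the replaced matrix need not be Hermitian.\<close>

lemma cdet_replace_col:
  assumes B: "B \<in> carrier_mat n n" and \<beta>: "\<beta> \<subseteq> {..<n}" "i \<in> \<beta>" "hermitian_on \<beta> B"
  shows "cdet \<beta> i (replace_col B i c) = cramer_sum B \<beta> i (($) c)"
proof -
  let ?C = "replace_col B i c"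
  have fin: "finite \<beta>" using \<beta>(1) finite_subset by blast
  have entry: "?C $$ (x, y) = (if y = i then c $ x else B $$ (x, y))" if "x \<in> \<beta>" "y \<in> \<beta>" for x y
  proof -
    have "x < n" "y < n" using that \<beta>(1) by auto
    then show ?thesis using B by (simp add: replace_col_def)
  qed
  show ?thesis
    unfolding cdet_cycle_expansion[OF fin \<beta>(2)] cramer_sum_def
  proof (rule sum.cong[OF refl])
    fix l assume l: "l \<in> distinct_lists (\<beta> - {i})"
    note l' = distinct_listsD[OF l]
    let ?\<gamma> = "\<beta> - {i} - set l"
    have "path_prod ?C (i # l @ [i]) = path_prod ?C (i # l) * ?C $$ (last (i # l), i)"
      using path_prod_snoc[of "i # l" ?C i] by simp
    also have "?C $$ (last (i # l), i) = c $ last (i # l)"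
      using entry[OF last_path_in[OF \<beta>(2) l] \<beta>(2)] by simp
    also have "path_prod ?C (i # l) = path_prod B (i # l)"
    proof (rule path_prod_cong, intro ballI)
      fix x y assume "x \<in> set (butlast (i # l))" "y \<in> set (tl (i # l))"
      then have "x \<in> \<beta>" "y \<in> \<beta>" "y \<noteq> i"
        using l' \<beta>(2) in_set_butlastD[of x "i # l"] by auto
      then show "?C $$ (x, y) = B $$ (x, y)" using entry by simp
    qed
    finally have 1: "path_prod ?C (i # l @ [i]) = path_prod B (i # l) * c $ last (i # l)" .
    have "cdet_min ?C ?\<gamma> = cdet_min B ?\<gamma>"
      using fin entry by (intro cdet_min_cong) auto
    also have "\<dots> = quat_of_real (minor B ?\<gamma>)"
    proof -
      have "hermitian_on ?\<gamma> B" by (rule hermitian_on_subset[OF \<beta>(3)]) auto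
      then show ?thesis using hermitian_dets[of ?\<gamma> B] fin by simp
    qed
    finally show "(- 1) ^ length l * (cdet_min ?C ?\<gamma> * path_prod ?C (i # l @ [i])) =
      (- 1) ^ length l * (quat_of_real (minor B ?\<gamma>) * path_prod B (i # l)) * c $ last (i # l)"
      by (simp add: 1 mult.assoc)
  qed
qed

text \<open>An adjugate entry is the Cramer sum for a unit column.\<close>

definition adj_entry :: "quat mat \<Rightarrow> nat set \<Rightarrow> nat \<Rightarrow> nat \<Rightarrow> quat" where
  "adj_entry B \<beta> i j = cramer_sum B \<beta> i (\<lambda>k. if k = j then 1 else 0)"

lemma cramer_sum_eq_adj_entry:
  assumes "\<beta> \<subseteq> {..<n}" "i \<in> \<beta>"
  shows "cramer_sum B \<beta> i c = (\<Sum>j<n. adj_entry B \<beta> i j * c j)"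
  unfolding adj_entry_def cramer_sum_sum[symmetric]
  using assms by (intro cramer_sum_cong) (auto simp: sum.delta if_distrib[of "\<lambda>x. x * _"] cong: if_cong)

lemma adj_entry_outside:
  assumes "i \<in> \<beta>" "j \<notin> \<beta>"
  shows "adj_entry B \<beta> i j = 0"
proof -
  have "adj_entry B \<beta> i j = cramer_sum B \<beta> i (\<lambda>_. 0)"
    unfolding adj_entry_def using assms by (intro cramer_sum_cong) auto
  then show ?thesis by (simp add: cramer_sum_def)
qed

text \<open>A simple path that starts and ends at \<open>i\<close> has no other vertex, so only the
  empty list contributes.\<close>

lemma adj_entry_diag:
  assumes "finite \<beta>" "i \<in> \<beta>"
  shows "adj_entry B \<beta> i i = quat_of_real (minor B (\<beta> - {i}))"
proof -
  have "last (i # l) = i \<longleftrightarrow> l = []" if "l \<in> distinct_lists (\<beta> - {i})" for l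
    using distinct_listsD(1)[OF that] last_in_set[of l] by auto
  then have "adj_entry B \<beta> i i = (\<Sum>l\<in>distinct_lists (\<beta> - {i}).
      if l = [] then quat_of_real (minor B (\<beta> - {i})) else 0)"
    unfolding adj_entry_def cramer_sum_def by (intro sum.cong refl) auto
  also have "\<dots> = quat_of_real (minor B (\<beta> - {i}))"
    using assms by (simp add: sum.delta) (simp add: distinct_lists_def)
  finally show ?thesis .
qed

text \<open>The entry of column \<open>j\<close> prolongs the path by an edge to \<open>j\<close>, a
  vertex that may already lie on the path.\<close>

lemma cramer_sum_col:
  "cramer_sum B \<beta> i (\<lambda>k. B $$ (k, j)) = (\<Sum>l\<in>distinct_lists (\<beta> - {i}). (- 1) ^ length l *
     (quat_of_real (minor B (\<beta> - {i} - set l)) * path_prod B (i # l @ [j])))"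
  unfolding cramer_sum_def using path_prod_snoc[of "i # l" B j for l] by (simp add: mult.assoc)

text \<open>The added edge closes the path to a cycle through \<open>i\<close>, which gives back the
  cycle expansion of the minor.\<close>

lemma cramer_sum_col_self:
  assumes "finite \<beta>" "i \<in> \<beta>" "hermitian_on \<beta> B"
  shows "cramer_sum B \<beta> i (\<lambda>k. B $$ (k, i)) = quat_of_real (minor B \<beta>)"
  unfolding cramer_sum_col minor_eq_expansion[OF assms(1,3,2)] quat_of_real_commute ..

text \<open>Expansion by alien cofactors. A path that avoids \<open>j\<close> until its end, with a
  cycle through \<open>j\<close> taken from the complementary minor, has the same word as the path
  that visits \<open>j\<close>, runs round this cycle and ends at \<open>j\<close>. The latter has
  one more interior vertex, so the terms cancel.\<close>

lemma cramer_sum_col_inside: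
  assumes "finite \<beta>" "i \<in> \<beta>" "j \<in> \<beta>" "i \<noteq> j" "hermitian_on \<beta> B"
  shows "cramer_sum B \<beta> i (\<lambda>k. B $$ (k, j)) = 0"
proof -
  let ?\<delta> = "\<beta> - {i, j}"
  let ?h = "\<lambda>u v. (- 1) ^ (length u + length v) * (quat_of_real (minor B (?\<delta> - set u - set v)) *
     (path_prod B (i # u @ [j]) * path_prod B (j # v @ [j])))"
  have ins: "\<beta> - {i} = insert j ?\<delta>" using assms by auto
  have 1: "(- 1) ^ length u * (quat_of_real (minor B (insert j ?\<delta> - set u)) *
      path_prod B (i # u @ [j])) = (\<Sum>v\<in>distinct_lists (?\<delta> - set u). ?h u v)"
    if u: "u \<in> distinct_lists ?\<delta>" for u
  proof -
    have ju: "j \<notin> set u" using u by (auto simp: distinct_lists_def)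
    then have e: "insert j ?\<delta> - set u - {j} = ?\<delta> - set u" by auto
    have "quat_of_real (minor B (insert j ?\<delta> - set u)) =
      (\<Sum>v\<in>distinct_lists (?\<delta> - set u). (- 1) ^ length v *
        (path_prod B (j # v @ [j]) * quat_of_real (minor B (?\<delta> - set u - set v))))"
      using minor_eq_expansion[of "insert j ?\<delta> - set u" B j] assms ju
        hermitian_on_subset[OF assms(5), of "insert j ?\<delta> - set u"] unfolding e by auto
    then show ?thesis
      unfolding quat_of_real_commute[of "minor B (insert j ?\<delta> - set u)"]
      by (simp add: sum_distrib_left sign_real_rearrange)
  qed
  have 2: "(- 1) ^ length (u @ j # v) * (quat_of_real (minor B (insert j ?\<delta> - set (u @ j # v))) *
      path_prod B (i # (u @ j # v) @ [j])) = - ?h u v" for u v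
  proof -
    have "path_prod B (i # (u @ j # v) @ [j]) = path_prod B (i # u @ [j]) * path_prod B (j # v @ [j])"
      using path_prod_append[of B "i # u" j "v @ [j]"] by simp
    moreover have "insert j ?\<delta> - set (u @ j # v) = ?\<delta> - set u - set v" by auto
    ultimately show ?thesis by simp
  qed
  show ?thesis
    unfolding cramer_sum_col ins
    by (subst sum_distinct_lists_split)
      (use assms(1) in \<open>simp_all only: 1 2 cong: sum.cong, auto simp: sum_negf\<close>)
qed

text \<open>The added edge yields a simple path to \<open>j\<close> within
  \<open>insert j \<beta>\<close>. The complement is the same, and \<open>j\<close> joins the list
  of vertices, which costs a sign.\<close>

lemma cramer_sum_col_outside:
  assumes "finite \<beta>" "i \<in> \<beta>" "j \<notin> \<beta>"
  shows "cramer_sum B \<beta> i (\<lambda>k. B $$ (k, j)) = - adj_entry B (insert j \<beta>) i j"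
proof -
  let ?e = "\<lambda>k. if k = j then 1 else (0 :: quat)"
  let ?t = "\<lambda>l. (- 1) ^ length l * (quat_of_real (minor B (insert j (\<beta> - {i}) - set l)) *
     path_prod B (i # l)) * ?e (last (i # l))"
  have ins: "insert j \<beta> - {i} = insert j (\<beta> - {i})" using assms by auto
  have 1: "?t l = 0" if "l \<in> distinct_lists (\<beta> - {i})" for l
    using last_path_in[OF assms(2) that] assms(3) by auto
  have 2: "(\<Sum>v\<in>distinct_lists (\<beta> - {i} - set u). ?t (u @ j # v)) =
    - ((- 1) ^ length u * (quat_of_real (minor B (\<beta> - {i} - set u)) * path_prod B (i # u @ [j])))"
    if u: "u \<in> distinct_lists (\<beta> - {i})" for u
  proof -
    \<comment> \<open>A nonempty \<open>v\<close> would move the end of the path away from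
      \<open>j\<close>.\<close>
    have "(\<Sum>v\<in>distinct_lists (\<beta> - {i} - set u). ?t (u @ j # v)) =
      (\<Sum>v\<in>distinct_lists (\<beta> - {i} - set u). if v = [] then ?t (u @ [j]) else 0)"
    proof (rule sum.cong[OF refl])
      fix v assume "v \<in> distinct_lists (\<beta> - {i} - set u)"
      then have "j \<notin> set v" using assms(3) by (auto simp: distinct_lists_def)
      then show "?t (u @ j # v) = (if v = [] then ?t (u @ [j]) else 0)"
        using last_in_set[of v] by auto
    qed
    also have "\<dots> = ?t (u @ [j])"
      using assms(1) by (simp add: sum.delta) (simp add: distinct_lists_def)
    also have "insert j (\<beta> - {i}) - set (u @ [j]) = \<beta> - {i} - set u"
      using assms(3) by auto
    finally show ?thesis by simp
  qed
  show ?thesis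
    unfolding adj_entry_def cramer_sum_col unfolding cramer_sum_def ins
    by (subst sum_distinct_lists_split)
      (use assms in \<open>simp_all only: 1 2 cong: sum.cong, auto simp: sum_negf\<close>)
qed

section \<open>Quaternion matrices\<close>

text \<open>Dimension equations in place of carrier sets let the simplifier discharge the side
  conditions while rebracketing.\<close>

lemma mult_mat_assoc:
  fixes A :: "'a :: semiring_0 mat"
  assumes "dim_col A = dim_row B" "dim_col B = dim_row C"
  shows "A * B * C = A * (B * C)"
  using assms by (intro assoc_mult_mat[of _ "dim_row A" "dim_row B" _ "dim_row C" _ "dim_col C"]) auto

lemma mult_mat_diff_distrib:
  fixes A :: "'a :: ring mat"
  assumes "dim_col A = dim_row B" "dim_row B = dim_row C" "dim_col B = dim_col C"
  shows "A * (B - C) = A * B - A * C"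
  using assms
  by (intro mult_minus_distrib_mat[of _ "dim_row A" "dim_row B" _ "dim_col B"] carrier_matI) simp_all

lemma mat_diff_eq_zero:
  fixes A B :: "'a :: group_add mat"
  assumes "A \<in> carrier_mat m n" "B \<in> carrier_mat m n" "A - B = 0\<^sub>m m n"
  shows "A = B"
proof (rule eq_matI)
  fix i j assume "i < dim_row B" "j < dim_col B"
  then show "A $$ (i, j) = B $$ (i, j)"
    using arg_cong[OF assms(3), of "\<lambda>X. X $$ (i, j)"] assms(1,2) by simp
qed (use assms in auto)

lemma mult_mat_entry:
  assumes "dim_col A = dim_row B" "i < dim_row A" "j < dim_col B"
  shows "(A * B) $$ (i, j) = (\<Sum>k<dim_row B. A $$ (i, k) * B $$ (k, j))"
  using assms by (simp add: scalar_prod_def lessThan_atLeast0)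

lemma qadj_dim [simp]: "dim_row (qadj A) = dim_col A" "dim_col (qadj A) = dim_row A"
  by (simp_all add: qadj_def)

lemma qadj_carrier [simp]: "qadj A \<in> carrier_mat n m \<longleftrightarrow> A \<in> carrier_mat m n"
  by (metis carrier_matD carrier_matI qadj_dim)

lemma qadj_entry [simp]: "i < dim_col A \<Longrightarrow> j < dim_row A \<Longrightarrow> qadj A $$ (i, j) = qcnj (A $$ (j, i))"
  by (simp add: qadj_def)

lemma qadj_qadj [simp]: "qadj (qadj A) = A"
  by (intro eq_matI) auto

lemma qadj_mult: "dim_col A = dim_row B \<Longrightarrow> qadj (A * B) = qadj B * qadj A"
  by (intro eq_matI) (simp_all add: mult_mat_entry qcnj_sum del: index_mult_mat(1))

lemma qadj_minus:
  "dim_row A = dim_row B \<Longrightarrow> dim_col A = dim_col B \<Longrightarrow> qadj (A - B) = qadj A - qadj B"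
  by (intro eq_matI) auto

lemma qadj_real_smult: "qadj (quat_of_real t \<cdot>\<^sub>m A) = quat_of_real t \<cdot>\<^sub>m qadj A"
  by (intro eq_matI) (auto simp: quat_of_real_commute)

lemma qadj_one [simp]: "qadj (1\<^sub>m n) = 1\<^sub>m n"
  by (intro eq_matI) auto

lemma qadj_zero [simp]: "qadj (0\<^sub>m m n) = 0\<^sub>m n m"
  by (intro eq_matI) auto

lemma real_smult_smult:
  "quat_of_real s \<cdot>\<^sub>m (quat_of_real t \<cdot>\<^sub>m A) = quat_of_real (s * t) \<cdot>\<^sub>m A"
  by (intro eq_matI) (simp_all add: mult.assoc)

lemma mult_real_smult_left:
  "dim_col A = dim_row B \<Longrightarrow> (quat_of_real t \<cdot>\<^sub>m A) * B = quat_of_real t \<cdot>\<^sub>m (A * B)"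
  by (intro eq_matI) (auto simp: mult_mat_entry sum_distrib_left mult.assoc simp del: index_mult_mat(1))

lemma mult_real_smult_right:
  "dim_col A = dim_row B \<Longrightarrow> A * (quat_of_real t \<cdot>\<^sub>m B) = quat_of_real t \<cdot>\<^sub>m (A * B)"
  by (intro eq_matI)
     (auto simp: mult_mat_entry sum_distrib_left quat_of_real_left_commute simp del: index_mult_mat(1))

lemma qhermitian_entry:
  "qhermitian B \<Longrightarrow> i < dim_row B \<Longrightarrow> j < dim_row B \<Longrightarrow> B $$ (j, i) = qcnj (B $$ (i, j))"
  unfolding qhermitian_def by (metis qadj_dim(2) qadj_entry)

lemma qhermitian_hermitian_on:
  assumes "B \<in> carrier_mat n n" "qhermitian B" "\<beta> \<subseteq> {..<n}"
  shows "hermitian_on \<beta> B"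
  using assms qhermitian_entry[OF assms(2)] by (auto simp: hermitian_on_def)

text \<open>Each diagonal entry of \<open>qadj E * E\<close> is the sum of the squared norms in one
  column of \<open>E\<close>.\<close>

lemma qadj_mult_self_eq_zero:
  assumes "qadj E * E = 0\<^sub>m (dim_col E) (dim_col E)"
  shows "E = 0\<^sub>m (dim_row E) (dim_col E)"
proof (rule eq_matI; simp)
  fix i j assume ij: "i < dim_row E" "j < dim_col E"
  let ?q = "\<lambda>k. qre (qcnj (E $$ (k, j)) * E $$ (k, j))"
  have sq: "qre (qcnj x * x) = (qre x)\<^sup>2 + (qi x)\<^sup>2 + (qj x)\<^sup>2 + (qk x)\<^sup>2" for x
    by (simp add: quat_times_components power2_eq_square)
  have "(\<Sum>k<dim_row E. ?q k) = qre ((qadj E * E) $$ (j, j))"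
    using ij(2) by (simp add: mult_mat_entry qre_sum del: index_mult_mat(1))
  then have "(\<Sum>k<dim_row E. ?q k) = 0" using ij(2) assms by simp
  then have "?q i = 0" using ij(1) by (subst (asm) sum_nonneg_eq_0_iff) (auto simp: sq)
  then show "E $$ (i, j) = 0" using quat_norm_sq_pos[of "E $$ (i, j)"] unfolding sq by fastforce
qed

text \<open>A diagonal entry of \<open>qadj E * P * E\<close> is the quadratic form of
  \<open>P\<close> at a column of \<open>E\<close>.\<close>

lemma qpositive_definite_eq_zero:
  assumes P: "P \<in> carrier_mat n n" "qpositive_definite P"
    and E: "E \<in> carrier_mat n k" "qadj E * P * E = 0\<^sub>m k k"
  shows "E = 0\<^sub>m n k"
proof (rule eq_matI; simp)
  fix i j assume ij: "i < n" "j < k"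
  let ?x = "col E j"
  have x: "?x \<in> carrier_vec n" using E by (intro carrier_vecI) simp
  have "qadj E * P * E = qadj E * (P * E)" using P E by (intro mult_mat_assoc) auto
  moreover have "(qadj E * (P * E)) $$ (j, j) = map_vec qcnj ?x \<bullet> (P *\<^sub>v ?x)"
    using P(1) E(1) ij by (auto simp: scalar_prod_def intro!: sum.cong)
  ultimately have "map_vec qcnj ?x \<bullet> (P *\<^sub>v ?x) = (0\<^sub>m k k) $$ (j, j)" using E(2) by metis
  then have "map_vec qcnj ?x \<bullet> (P *\<^sub>v ?x) = 0" using ij by simp
  then have "?x = 0\<^sub>v n"
    using P x unfolding qpositive_definite_def by (metis carrier_matD(1) less_irrefl quat_of_real_simps(8))
  then have "?x $ i = 0" using ij by simp
  then show "E $$ (i, j) = 0" using E ij by simp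
qed (use E in auto)

section \<open>Sums of adjugates of principal submatrices\<close>

text \<open>Over a commutative field this is the coefficient of t^(n-k) in the adjugate of t I + B.
  Sets that miss \<open>j\<close> contribute zero by \<open>adj_entry_outside\<close>.\<close>

definition adj_sum :: "quat mat \<Rightarrow> nat \<Rightarrow> nat \<Rightarrow> quat mat" where
  "adj_sum B n k = mat n n (\<lambda>(i, j). \<Sum>\<beta> | \<beta> \<in> index_sets k n \<and> i \<in> \<beta>. adj_entry B \<beta> i j)"

definition minor_sum :: "quat mat \<Rightarrow> nat \<Rightarrow> nat \<Rightarrow> real" where
  "minor_sum B n k = (\<Sum>\<beta>\<in>index_sets k n. minor B \<beta>)"

lemma index_setsD:
  assumes "\<beta> \<in> index_sets k n"
  shows "\<beta> \<subseteq> {..<n}" "finite \<beta>" "card \<beta> = k"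
  using assms finite_subset by (auto simp: index_sets_def)

lemma finite_index_sets [simp]: "finite (index_sets k n)"
  by (rule finite_subset[of _ "Pow {..<n}"]) (auto simp: index_sets_def)

lemma index_sets_0 [simp]: "index_sets 0 n = {{}}"
  by (auto simp: index_sets_def dest: finite_subset[OF _ finite_lessThan])

lemma index_sets_empty: "k > n \<Longrightarrow> index_sets k n = {}"
  using card_mono[of "{..<n}"] by (metis card_lessThan equals0I finite_lessThan index_setsD(1,3) not_less)

lemma adj_sum_carrier [simp]: "adj_sum B n k \<in> carrier_mat n n"
  "dim_row (adj_sum B n k) = n" "dim_col (adj_sum B n k) = n"
  by (simp_all add: adj_sum_def)

lemma adj_sum_0: "adj_sum B n 0 = 0\<^sub>m n n"
  by (intro eq_matI) (auto simp: adj_sum_def intro!: sum.neutral)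

lemma adj_sum_large: "k > n \<Longrightarrow> adj_sum B n k = 0\<^sub>m n n"
  by (intro eq_matI) (auto simp: adj_sum_def index_sets_empty)

text \<open>The condition \<open>Q\<close>, insensitive to \<open>i\<close>, serves to keep a second
  index in the sets while \<open>i\<close> is inserted.\<close>

lemma sum_index_sets_insert:
  assumes "i < n" and "\<And>\<beta>. Q (insert i \<beta>) = Q \<beta>"
  shows "(\<Sum>\<beta> | \<beta> \<in> index_sets (Suc k) n \<and> i \<in> \<beta> \<and> Q \<beta>. f \<beta>) =
    (\<Sum>\<beta> | \<beta> \<in> index_sets k n \<and> i \<notin> \<beta> \<and> Q \<beta>. f (insert i \<beta>))"
proof (rule sum.reindex_bij_witness[of _ "insert i" "\<lambda>\<beta>. \<beta> - {i}"], goal_cases)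
  case (2 \<beta>)
  then show ?case using assms(2)[of "\<beta> - {i}"]
    by (auto simp: index_sets_def insert_absorb)
next
  case (4 \<beta>)
  then show ?case using assms finite_subset[of \<beta> "{..<n}"] by (auto simp: index_sets_def)
qed (auto simp: insert_absorb)

lemma adj_sum_diag:
  assumes "i < n"
  shows "adj_sum B n (Suc k) $$ (i, i) =
    quat_of_real (\<Sum>\<beta> | \<beta> \<in> index_sets k n \<and> i \<notin> \<beta>. minor B \<beta>)"
proof -
  have "adj_sum B n (Suc k) $$ (i, i) =
      (\<Sum>\<beta> | \<beta> \<in> index_sets (Suc k) n \<and> i \<in> \<beta>. quat_of_real (minor B (\<beta> - {i})))"
    using assms by (auto simp: adj_sum_def adj_entry_diag index_setsD intro!: sum.cong)
  also have "\<dots> = (\<Sum>\<beta> | \<beta> \<in> index_sets k n \<and> i \<notin> \<beta>. quat_of_real (minor B (insert i \<beta> - {i})))"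
    using sum_index_sets_insert[where Q = "\<lambda>_. True" and i = i and n = n and
      f = "\<lambda>\<beta>. quat_of_real (minor B (\<beta> - {i}))"] assms by simp
  also have "\<dots> = (\<Sum>\<beta> | \<beta> \<in> index_sets k n \<and> i \<notin> \<beta>. quat_of_real (minor B \<beta>))"
    by (intro sum.cong) auto
  finally show ?thesis by (simp add: quat_of_real_sum)
qed

text \<open>By linearity, multiplication by \<open>C\<close> replaces the unit columns by the
  columns of \<open>C\<close>.\<close>

lemma adj_sum_mult_entry:
  assumes "C \<in> carrier_mat n p" "i < n" "j < p"
  shows "(adj_sum B n k * C) $$ (i, j) =
    (\<Sum>\<beta> | \<beta> \<in> index_sets k n \<and> i \<in> \<beta>. cramer_sum B \<beta> i (\<lambda>l. C $$ (l, j)))"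
proof -
  have "(adj_sum B n k * C) $$ (i, j) = (\<Sum>l<n. \<Sum>\<beta> | \<beta> \<in> index_sets k n \<and> i \<in> \<beta>.
      adj_entry B \<beta> i l * C $$ (l, j))"
    using assms by (simp add: mult_mat_entry adj_sum_def sum_distrib_right del: index_mult_mat(1))
  also have "\<dots> = (\<Sum>\<beta> | \<beta> \<in> index_sets k n \<and> i \<in> \<beta>. \<Sum>l<n. adj_entry B \<beta> i l * C $$ (l, j))"
    by (rule sum.swap)
  also have "\<dots> = (\<Sum>\<beta> | \<beta> \<in> index_sets k n \<and> i \<in> \<beta>. cramer_sum B \<beta> i (\<lambda>l. C $$ (l, j)))"
    by (intro sum.cong refl cramer_sum_eq_adj_entry[symmetric]) (auto dest: index_setsD)
  finally show ?thesis .
qed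

text \<open>On the diagonal, sets containing \<open>i\<close> give their minors through the product,
  and sets avoiding \<open>i\<close> give theirs through the next adjugate sum. Off the diagonal,
  sets containing \<open>j\<close> vanish, and the others match the sets enlarged by
  \<open>j\<close> with opposite sign.\<close>

theorem adj_sum_Suc:
  assumes B: "B \<in> carrier_mat n n" "qhermitian B"
  shows "adj_sum B n (Suc k) = quat_of_real (minor_sum B n k) \<cdot>\<^sub>m 1\<^sub>m n - adj_sum B n k * B"
proof (rule eq_matI)
  fix i j
  assume "i < dim_row (quat_of_real (minor_sum B n k) \<cdot>\<^sub>m 1\<^sub>m n - adj_sum B n k * B)"
    "j < dim_col (quat_of_real (minor_sum B n k) \<cdot>\<^sub>m 1\<^sub>m n - adj_sum B n k * B)"
  then have ij: "i < n" "j < n" using B by auto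
  note herm = qhermitian_hermitian_on[OF B]
  have "adj_sum B n (Suc k) $$ (i, j) + (adj_sum B n k * B) $$ (i, j) =
    (if i = j then quat_of_real (minor_sum B n k) else 0)"
  proof (cases "i = j")
    case True
    have "(adj_sum B n k * B) $$ (i, i) =
        (\<Sum>\<beta> | \<beta> \<in> index_sets k n \<and> i \<in> \<beta>. quat_of_real (minor B \<beta>))"
      unfolding adj_sum_mult_entry[OF B(1) ij(1) ij(1)]
      by (intro sum.cong refl cramer_sum_col_self herm) (auto dest: index_setsD)
    moreover have "minor_sum B n k = (\<Sum>\<beta> | \<beta> \<in> index_sets k n \<and> i \<notin> \<beta>. minor B \<beta>) +
        (\<Sum>\<beta> | \<beta> \<in> index_sets k n \<and> i \<in> \<beta>. minor B \<beta>)"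
      unfolding minor_sum_def
      by (subst sum.union_disjoint[symmetric]) (auto intro!: sum.cong)
    ultimately show ?thesis using True adj_sum_diag[OF ij(1), of B k] by (simp add: quat_of_real_sum)
  next
    case False
    have "(adj_sum B n k * B) $$ (i, j) = (\<Sum>\<beta> | \<beta> \<in> index_sets k n \<and> i \<in> \<beta>.
        if j \<notin> \<beta> then - adj_entry B (insert j \<beta>) i j else 0)"
      unfolding adj_sum_mult_entry[OF B(1) ij]
      using False
      by (intro sum.cong refl)
         (auto simp: cramer_sum_col_inside cramer_sum_col_outside herm index_setsD)
    also have "\<dots> = - (\<Sum>\<beta> | \<beta> \<in> index_sets k n \<and> j \<notin> \<beta> \<and> i \<in> \<beta>. adj_entry B (insert j \<beta>) i j)"
      unfolding sum_negf[symmetric] by (subst sum.inter_filter[symmetric]) (auto intro!: sum.cong)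
    also have "(\<Sum>\<beta> | \<beta> \<in> index_sets k n \<and> j \<notin> \<beta> \<and> i \<in> \<beta>. adj_entry B (insert j \<beta>) i j) =
        (\<Sum>\<beta> | \<beta> \<in> index_sets (Suc k) n \<and> j \<in> \<beta> \<and> i \<in> \<beta>. adj_entry B \<beta> i j)"
      using False ij by (intro sum_index_sets_insert[symmetric]) auto
    \<comment> \<open>Sets without \<open>j\<close> may be added, since their adjugates have no
      column \<open>j\<close>.\<close>
    also have "\<dots> = adj_sum B n (Suc k) $$ (i, j)"
      using ij by (auto simp: adj_sum_def intro!: sum.mono_neutral_left)
        (metis adj_entry_outside)
    finally show ?thesis using False by simp
  qed
  then show "adj_sum B n (Suc k) $$ (i, j) =
      (quat_of_real (minor_sum B n k) \<cdot>\<^sub>m 1\<^sub>m n - adj_sum B n k * B) $$ (i, j)"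
    using ij B by (auto simp: eq_diff_eq simp del: index_mult_mat(1))
qed (use B in auto)

text \<open>Each set is counted once for every index outside it. Subtraction of reals keeps the
  formula valid for \<open>k > n\<close>, where both sides are zero.\<close>

lemma qre_trace_adj_sum:
  "(\<Sum>i<n. qre (adj_sum B n (Suc k) $$ (i, i))) = (real n - real k) * minor_sum B n k"
proof -
  have "(\<Sum>i<n. qre (adj_sum B n (Suc k) $$ (i, i))) =
      (\<Sum>i<n. \<Sum>\<beta>\<in>index_sets k n. if i \<notin> \<beta> then minor B \<beta> else 0)"
    by (intro sum.cong refl) (simp add: adj_sum_diag sum.inter_filter[symmetric])
  also have "\<dots> = (\<Sum>\<beta>\<in>index_sets k n. \<Sum>i<n. if i \<notin> \<beta> then minor B \<beta> else 0)"
    by (rule sum.swap)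
  also have "\<dots> = (\<Sum>\<beta>\<in>index_sets k n. (real n - real k) * minor B \<beta>)"
  proof (rule sum.cong[OF refl])
    fix \<beta> assume \<beta>: "\<beta> \<in> index_sets k n"
    have "(\<Sum>i<n. if i \<notin> \<beta> then minor B \<beta> else 0) = real (card ({..<n} - \<beta>)) * minor B \<beta>"
      by (subst sum.inter_filter[symmetric]) (auto simp: set_diff_eq)
    moreover have "card ({..<n} - \<beta>) = n - k" "k \<le> n"
      using index_setsD[OF \<beta>] card_mono[of "{..<n}" \<beta>] by (auto simp: card_Diff_subset)
    ultimately show "(\<Sum>i<n. if i \<notin> \<beta> then minor B \<beta> else 0) = (real n - real k) * minor B \<beta>"
      by (simp add: of_nat_diff)
  qed
  finally show ?thesis by (simp add: minor_sum_def sum_distrib_left)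
qed

text \<open>By the recursion, \<open>adj_sum B n k\<close> is a polynomial in \<open>B\<close> with
  real coefficients.\<close>

lemma adj_sum_commute_hermitian:
  assumes B: "B \<in> carrier_mat n n" "qhermitian B"
  shows "adj_sum B n k * B = B * adj_sum B n k \<and> qadj (adj_sum B n k) = adj_sum B n k"
proof (induction k)
  case 0
  show ?case using B by (simp add: adj_sum_0)
next
  case (Suc k)
  let ?S = "adj_sum B n k" and ?d = "quat_of_real (minor_sum B n k)"
  have [simp]: "dim_row B = n" "dim_col B = n" "B \<in> carrier_mat n n" using B by auto
  have "(?d \<cdot>\<^sub>m 1\<^sub>m n - ?S * B) * B = ?d \<cdot>\<^sub>m 1\<^sub>m n * B - ?S * B * B"
    by (rule minus_mult_distrib_mat) auto
  also have "\<dots> = B * (?d \<cdot>\<^sub>m 1\<^sub>m n) - B * (?S * B)"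
    using Suc by (simp add: mult_real_smult_left mult_real_smult_right mult_mat_assoc)
  also have "\<dots> = B * (?d \<cdot>\<^sub>m 1\<^sub>m n - ?S * B)"
    by (rule mult_minus_distrib_mat[symmetric]) auto
  finally have 1: "(?d \<cdot>\<^sub>m 1\<^sub>m n - ?S * B) * B = B * (?d \<cdot>\<^sub>m 1\<^sub>m n - ?S * B)" .
  have "qadj (?d \<cdot>\<^sub>m 1\<^sub>m n - ?S * B) = ?d \<cdot>\<^sub>m 1\<^sub>m n - ?S * B"
    using Suc B by (simp add: qadj_minus qadj_real_smult qadj_mult qhermitian_def)
  with 1 show ?case unfolding adj_sum_Suc[OF B] by blast
qed

text \<open>For \<open>s\<close> the largest size with a nonzero sum of principal minors, the Cayley-Hamilton
  recursion shows that \<open>adj_sum B n (Suc s)\<close> is annihilated by a power of \<open>B\<close>, hence by the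
  Hermitian matrix \<open>B\<close> itself.\<close>

lemma exists_top_minor_sum:
  assumes B: "B \<in> carrier_mat n n" "qhermitian B"
  obtains s where "minor_sum B n s \<noteq> 0"
    "adj_sum B n s * B * B = quat_of_real (minor_sum B n s) \<cdot>\<^sub>m B"
    "(\<Sum>i<n. qre ((adj_sum B n s * B) $$ (i, i))) = real s * minor_sum B n s"
proof -
  have [simp]: "dim_row B = n" "dim_col B = n" "B \<in> carrier_mat n n" using B by auto
  let ?K = "{k. k \<le> n \<and> minor_sum B n k \<noteq> 0}"
  \<comment> \<open>The minor of the empty set is 1, so a largest size exists even for
    \<open>B = 0\<close>.\<close>
  have "0 \<in> ?K" by (simp add: minor_sum_def)
  define s where "s = Max ?K"
  have "finite ?K" "?K \<noteq> {}" using \<open>0 \<in> ?K\<close> by auto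
  then have s: "s \<in> ?K" unfolding s_def by (rule Max_in)
  have zero: "minor_sum B n k = 0" if "k > s" for k
  proof (cases "k \<le> n")
    case True
    then have "minor_sum B n k \<noteq> 0 \<Longrightarrow> k \<le> s"
      unfolding s_def by (intro Max_ge \<open>finite ?K\<close>) simp
    with that show ?thesis by linarith
  qed (simp add: minor_sum_def index_sets_empty)
  note com = adj_sum_commute_hermitian[OF B]
  have rec: "adj_sum B n (Suc k) = - (adj_sum B n k * B)" if "k > s" for k
    unfolding adj_sum_Suc[OF B] zero[OF that] by (intro eq_matI) auto
  \<comment> \<open>Two steps of the recursion give \<open>?S * B * B = 0\<close>. As
    \<open>?S\<close> and \<open>B\<close> are Hermitian and commute, \<open>?S * B\<close> has
    vanishing Gram matrix and is itself zero.\<close>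
  have step: "adj_sum B n (Suc k) = 0\<^sub>m n n" if "k > s" "adj_sum B n (Suc (Suc k)) = 0\<^sub>m n n" for k
  proof -
    let ?S = "adj_sum B n k"
    let ?E = "?S * B"
    have SBB: "?S * B * B = 0\<^sub>m n n"
    proof -
      have "?S * B * B = - (- (?S * B * B))" by (intro eq_matI) auto
      also have "\<dots> = adj_sum B n (Suc (Suc k))"
        using that(1) by (simp add: rec)
      finally show ?thesis using that(2) by simp
    qed
    have "qadj ?E * ?E = B * ?S * (?S * B)"
      using com[of k] B by (simp add: qadj_mult qhermitian_def)
    also have "\<dots> = ?S * B * (B * ?S)" using com[of k] by simp
    also have "\<dots> = ?S * B * B * ?S" by (simp add: mult_mat_assoc)
    also have "\<dots> = 0\<^sub>m n n" unfolding SBB by simp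
    finally have "?E = 0\<^sub>m n n" using qadj_mult_self_eq_zero[of ?E] by simp
    then show ?thesis unfolding rec[OF that(1)] by (intro eq_matI) auto
  qed
  have "adj_sum B n (Suc (Suc s)) = 0\<^sub>m n n"
  \<comment> \<open>Downward induction from a size exceeding \<open>n\<close>, where there are no
    index sets; starting at \<open>Suc n\<close> includes the case \<open>s = n\<close>.\<close>
  proof (rule inc_induct[of "Suc s" "Suc n" "\<lambda>k. adj_sum B n (Suc k) = 0\<^sub>m n n"])
    show "Suc s \<le> Suc n" using s by simp
    show "adj_sum B n (Suc (Suc n)) = 0\<^sub>m n n" by (rule adj_sum_large) simp
  qed (auto intro: step)
  then have "- (adj_sum B n (Suc s) * B) = 0\<^sub>m n n"
    using rec[of "Suc s"] by simp
  moreover have "adj_sum B n (Suc s) * B = - (- (adj_sum B n (Suc s) * B))"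
    by (intro eq_matI) auto
  moreover have "- 0\<^sub>m n n = (0\<^sub>m n n :: quat mat)" by (intro eq_matI) auto
  ultimately have "adj_sum B n (Suc s) * B = 0\<^sub>m n n" by metis
  then have Z: "(quat_of_real (minor_sum B n s) \<cdot>\<^sub>m 1\<^sub>m n - adj_sum B n s * B) * B = 0\<^sub>m n n"
    unfolding adj_sum_Suc[OF B] .
  have "quat_of_real (minor_sum B n s) \<cdot>\<^sub>m B - adj_sum B n s * B * B = 0\<^sub>m n n"
    unfolding Z[symmetric]
    by (subst minus_mult_distrib_mat[of _ n n]) (auto simp: mult_real_smult_left)
  then have "adj_sum B n s * B * B = quat_of_real (minor_sum B n s) \<cdot>\<^sub>m B"
    by (rule mat_diff_eq_zero[symmetric, OF carrier_matI carrier_matI, rotated 4]) simp_all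
  moreover have "(\<Sum>i<n. qre ((adj_sum B n s * B) $$ (i, i))) = real s * minor_sum B n s"
  proof -
    \<comment> \<open>The recursion reduces this trace to that of
      \<open>adj_sum B n (Suc s)\<close>, which is \<open>n - s\<close> times the minor sum.\<close>
    have "(\<Sum>i<n. qre ((adj_sum B n s * B) $$ (i, i))) =
        (\<Sum>i<n. minor_sum B n s - qre (adj_sum B n (Suc s) $$ (i, i)))"
      unfolding adj_sum_Suc[OF B] by (intro sum.cong refl) (simp del: index_mult_mat(1))
    then show ?thesis
      by (simp add: sum_subtractf qre_trace_adj_sum algebra_simps)
  qed
  ultimately show ?thesis using s that by blast
qed

section \<open>The rank as a trace\<close>

lemma qrank_column_basis:
  assumes A: "A \<in> carrier_mat m p" and r: "qrank A = r"
  obtains S V where "S \<subseteq> {..<p}" "card S = r" "right_indep_cols A S"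
    "\<And>i j. i < m \<Longrightarrow> j < p \<Longrightarrow> A $$ (i, j) = (\<Sum>s\<in>S. A $$ (i, s) * V s j)"
proof -
  let ?C = "{card S | S. S \<subseteq> {..<dim_col A} \<and> right_indep_cols A S}"
  have fin: "finite ?C"
    by (rule finite_subset[of _ "card ` Pow {..<dim_col A}"]) auto
  have "card {} \<in> ?C" by (force simp: right_indep_cols_def)
  then have "Max ?C \<in> ?C" using fin by (intro Max_in) auto
  then obtain S where S: "S \<subseteq> {..<p}" "card S = r" "right_indep_cols A S"
    using r A unfolding qrank_def by auto
  have finS: "finite S" using S(1) finite_subset by blast
  have "\<exists>c. \<forall>i<m. A $$ (i, j) = (\<Sum>s\<in>S. A $$ (i, s) * c s)" if j: "j < p" for j
  proof (cases "j \<in> S")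
    case True
    have "A $$ (i, j) = (\<Sum>s\<in>S. A $$ (i, s) * (if s = j then 1 else 0))" for i
      using True finS by (simp add: if_distrib[of "\<lambda>x. _ * x"] sum.delta cong: if_cong)
    then show ?thesis by (intro exI[of _ "\<lambda>s. if s = j then 1 else 0"]) blast
  next
    case False
    have "\<not> right_indep_cols A (insert j S)"
    proof
      assume "right_indep_cols A (insert j S)"
      then have "card (insert j S) \<in> ?C" using S(1) j A by blast
      then have "card (insert j S) \<le> r" using Max_ge[OF fin] r unfolding qrank_def by blast
      then show False using False finS S(2) by simp
    qed
    then obtain c where c: "\<And>i. i < m \<Longrightarrow> (\<Sum>s\<in>insert j S. A $$ (i, s) * c s) = 0"
      and nz: "\<not> (\<forall>s\<in>insert j S. c s = 0)"
      using A unfolding right_indep_cols_def by auto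
    have c': "A $$ (i, j) * c j + (\<Sum>s\<in>S. A $$ (i, s) * c s) = 0" if "i < m" for i
      using c[OF that] False finS by simp
    have cj: "c j \<noteq> 0"
    proof
      assume 0: "c j = 0"
      then have "\<forall>i<m. (\<Sum>s\<in>S. A $$ (i, s) * c s) = 0" using c' by simp
      then have "\<forall>s\<in>S. c s = 0" using S(3) A unfolding right_indep_cols_def by auto
      with 0 nz show False by blast
    qed
    \<comment> \<open>The division by \<open>c j\<close> takes place on the right, as befits a right
      vector space.\<close>
    have "A $$ (i, j) = (\<Sum>s\<in>S. A $$ (i, s) * (- c s * inverse (c j)))" if "i < m" for i
    proof -
      have "A $$ (i, j) * c j = (\<Sum>s\<in>S. A $$ (i, s) * - c s)"
        using c'[OF that] by (simp add: sum_negf eq_neg_iff_add_eq_0)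
      then have "A $$ (i, j) * c j * inverse (c j) = (\<Sum>s\<in>S. A $$ (i, s) * (- c s * inverse (c j)))"
        by (simp add: sum_distrib_right mult.assoc)
      then show ?thesis using cj by (simp add: mult.assoc)
    qed
    then show ?thesis by (intro exI[of _ "\<lambda>s. - c s * inverse (c j)"]) blast
  qed
  then obtain V where "\<And>i j. i < m \<Longrightarrow> j < p \<Longrightarrow> A $$ (i, j) = (\<Sum>s\<in>S. A $$ (i, s) * V j s)"
    by metis
  then show ?thesis using S that[of S "\<lambda>s j. V j s"] by blast
qed

text \<open>Write \<open>A\<close> as C V, where C consists of a column basis. The hypothesis makes
  V W C equal to \<open>d\<close> times the identity of order \<open>r\<close>, and the real part of
  the trace is cyclic.\<close>

lemma qre_trace_eq_qrank:
  assumes A: "A \<in> carrier_mat m p" and W: "W \<in> carrier_mat p m"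
    and P: "A * W * A = quat_of_real d \<cdot>\<^sub>m A" and r: "qrank A = r"
  shows "(\<Sum>i<m. qre ((A * W) $$ (i, i))) = real r * d"
proof -
  obtain S V where S: "S \<subseteq> {..<p}" "card S = r" "right_indep_cols A S"
    and V: "\<And>i j. i < m \<Longrightarrow> j < p \<Longrightarrow> A $$ (i, j) = (\<Sum>s\<in>S. A $$ (i, s) * V s j)"
    using qrank_column_basis[OF A r] by metis
  have finS: "finite S" using S(1) finite_subset by blast
  \<comment> \<open>This is V W C in coordinates; independence of the chosen columns identifies its
    diagonal.\<close>
  define U where "U t s = (\<Sum>k<p. V t k * (W * A) $$ (k, s))" for t s
  have Us: "U s s = quat_of_real d" if s: "s \<in> S" for s
  proof -
    have sp: "s < p" using s S(1) by auto
    have "(\<Sum>t\<in>S. A $$ (i, t) * (U t s - (if t = s then quat_of_real d else 0))) = 0" if i: "i < m" for i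
    proof -
      have "(\<Sum>t\<in>S. A $$ (i, t) * U t s) = (\<Sum>k<p. \<Sum>t\<in>S. A $$ (i, t) * V t k * (W * A) $$ (k, s))"
        unfolding U_def sum_distrib_left by (subst sum.swap) (simp add: mult.assoc)
      also have "\<dots> = (\<Sum>k<p. A $$ (i, k) * (W * A) $$ (k, s))"
        unfolding sum_distrib_right[symmetric] using V[OF i] by (intro sum.cong refl) simp
      also have "\<dots> = (A * (W * A)) $$ (i, s)"
        using A W i sp by (simp add: mult_mat_entry del: index_mult_mat(1))
      also have "A * (W * A) = quat_of_real d \<cdot>\<^sub>m A"
        using P A W by simp
      finally have "(\<Sum>t\<in>S. A $$ (i, t) * U t s) = A $$ (i, s) * quat_of_real d"
        using A i sp by (simp add: quat_of_real_commute)
      moreover have "(\<Sum>t\<in>S. A $$ (i, t) * (if t = s then quat_of_real d else 0)) =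
          A $$ (i, s) * quat_of_real d"
        using s finS by (simp add: if_distrib[of "\<lambda>x. _ * x"] sum.delta cong: if_cong)
      ultimately show ?thesis by (simp add: right_diff_distrib sum_subtractf)
    qed
    then have "\<forall>t\<in>S. U t s - (if t = s then quat_of_real d else 0) = 0"
      using S(3)[unfolded right_indep_cols_def, THEN spec,
          of "\<lambda>t. U t s - (if t = s then quat_of_real d else 0)"] A by simp
    then show ?thesis using s by fastforce
  qed
  have "(\<Sum>i<m. qre ((A * W) $$ (i, i))) =
      (\<Sum>i<m. \<Sum>k<p. \<Sum>s\<in>S. qre (A $$ (i, s) * (V s k * W $$ (k, i))))"
  proof (intro sum.cong refl)
    fix i assume "i \<in> {..<m}"
    then have i: "i < m" by simp
    have "qre ((A * W) $$ (i, i)) = (\<Sum>k<p. qre (A $$ (i, k) * W $$ (k, i)))"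
      using A W i by (simp add: mult_mat_entry qre_sum del: index_mult_mat(1))
    also have "\<dots> = (\<Sum>k<p. qre ((\<Sum>s\<in>S. A $$ (i, s) * V s k) * W $$ (k, i)))"
      using V[OF i] by (intro sum.cong refl) simp
    finally show "qre ((A * W) $$ (i, i)) =
        (\<Sum>k<p. \<Sum>s\<in>S. qre (A $$ (i, s) * (V s k * W $$ (k, i))))"
      by (simp add: sum_distrib_right qre_sum mult.assoc)
  qed
  also have "\<dots> = (\<Sum>i<m. \<Sum>s\<in>S. \<Sum>k<p. qre (V s k * W $$ (k, i) * A $$ (i, s)))"
    by (subst sum.swap) (simp add: qre_commute)
  also have "\<dots> = (\<Sum>s\<in>S. \<Sum>i<m. \<Sum>k<p. qre (V s k * (W $$ (k, i) * A $$ (i, s))))"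
    by (subst sum.swap) (simp add: mult.assoc)
  also have "\<dots> = (\<Sum>s\<in>S. \<Sum>k<p. \<Sum>i<m. qre (V s k * (W $$ (k, i) * A $$ (i, s))))"
    by (intro sum.cong refl sum.swap)
  also have "\<dots> = (\<Sum>s\<in>S. qre (U s s))"
    unfolding U_def using A W S(1)
    by (intro sum.cong refl)
       (simp add: qre_sum mult_mat_entry sum_distrib_left subset_iff del: index_mult_mat(1))
  also have "\<dots> = real r * d" using Us S(2) by simp
  finally show ?thesis .
qed

section \<open>Cramer's rule for singular Hermitian matrices\<close>

text \<open>The factorizations say that \<open>A\<close> and \<open>B\<close> have the same column
  space, so the rank may be read off either. The matrix \<open>adj_sum B n s * B\<close> acts on
  that space as a real scalar d, and its real trace is both s d and r d.\<close>

theorem adj_sum_qrank: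
  assumes B: "B \<in> carrier_mat n n" "qhermitian B"
    and A: "A \<in> carrier_mat n p" "K \<in> carrier_mat p n" "L \<in> carrier_mat n p"
    and BA: "B = A * K" "A = B * L" and r: "qrank A = r"
  shows "minor_sum B n r \<noteq> 0"
    "adj_sum B n r * B * B = quat_of_real (minor_sum B n r) \<cdot>\<^sub>m B"
proof -
  obtain s where nz: "minor_sum B n s \<noteq> 0"
    and SBB: "adj_sum B n s * B * B = quat_of_real (minor_sum B n s) \<cdot>\<^sub>m B"
    and tr: "(\<Sum>i<n. qre ((adj_sum B n s * B) $$ (i, i))) = real s * minor_sum B n s"
    using exists_top_minor_sum[OF B] by metis
  let ?S = "adj_sum B n s" and ?d = "minor_sum B n s"
  have [simp]: "dim_row B = n" "dim_col B = n" "dim_row A = n" "dim_col A = p"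
    "dim_row K = p" "dim_col K = n" "dim_row L = n" "dim_col L = p"
    using A B by auto
  have SB: "?S * B = A * (K * ?S)"
  proof -
    have "?S * B = (A * K) * ?S"
      using adj_sum_commute_hermitian[OF B] BA(1) by metis
    then show ?thesis by (simp add: mult_mat_assoc)
  qed
  have "A * (K * ?S) * A = ?S * B * (B * L)"
    using SB BA(2) by metis
  also have "\<dots> = ?S * B * B * L" by (simp add: mult_mat_assoc)
  also have "\<dots> = quat_of_real ?d \<cdot>\<^sub>m A"
    unfolding SBB by (subst mult_real_smult_left) (simp_all add: BA(2)[symmetric])
  finally have "A * (K * ?S) * A = quat_of_real ?d \<cdot>\<^sub>m A" .
  moreover have "K * ?S \<in> carrier_mat p n" by (rule carrier_matI) simp_all
  ultimately have "real s * ?d = real r * ?d"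
    using qre_trace_eq_qrank[OF A(1) _ _ r, of "K * ?S" ?d] tr unfolding SB by metis
  then have "s = r" using nz by simp
  with nz SBB show "minor_sum B n r \<noteq> 0"
    "adj_sum B n r * B * B = quat_of_real (minor_sum B n r) \<cdot>\<^sub>m B" by simp_all
qed

text \<open>The bound on \<open>r\<close> excludes the empty set, on which \<open>hdet\<close> is
  not determined.\<close>

lemma sum_hdet_eq_minor_sum:
  assumes B: "B \<in> carrier_mat n n" "qhermitian B" and "r \<ge> 1"
  shows "(\<Sum>\<beta>\<in>index_sets r n. hdet \<beta> B) = quat_of_real (minor_sum B n r)"
  unfolding minor_sum_def quat_of_real_sum
proof (intro sum.cong refl hdet_eq_minor)
  fix \<beta> assume \<beta>: "\<beta> \<in> index_sets r n"
  show "\<beta> \<noteq> {}" using index_setsD(3)[OF \<beta>] assms(3) by auto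
qed (auto dest: index_setsD intro: qhermitian_hermitian_on[OF B])

text \<open>As \<open>X = B * Y\<close>, the identity for \<open>?S * B * B\<close> gives
  \<open>?S * (B * X) = ?d X\<close>; the entries on the left are sums of column
  determinants.\<close>

theorem hermitian_cramer_rule:
  assumes B: "B \<in> carrier_mat n n" "qhermitian B"
    and A: "A \<in> carrier_mat n p" "K \<in> carrier_mat p n" "L \<in> carrier_mat n p"
    and BA: "B = A * K" "A = B * L" and r: "qrank A = r" "r \<ge> 1"
    and X: "X \<in> carrier_mat n q" "Y \<in> carrier_mat n q" "X = B * Y"
    and ij: "i < n" "j < q"
  shows "X $$ (i, j) = (\<Sum>\<beta> | \<beta> \<in> index_sets r n \<and> i \<in> \<beta>.
      cdet \<beta> i (replace_col B i (Matrix.col (B * X) j))) / (\<Sum>\<beta>\<in>index_sets r n. hdet \<beta> B)"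
proof -
  let ?S = "adj_sum B n r" and ?d = "minor_sum B n r"
  have [simp]: "dim_row B = n" "dim_col B = n" "dim_row Y = n" "dim_col Y = q" using B X by auto
  note nz = adj_sum_qrank(1)[OF B A BA r(1)] and SBB = adj_sum_qrank(2)[OF B A BA r(1)]
  note herm = qhermitian_hermitian_on[OF B]
  have "?S * (B * X) = ?S * B * B * Y" unfolding X(3) by (simp add: mult_mat_assoc)
  also have "\<dots> = quat_of_real ?d \<cdot>\<^sub>m X"
    unfolding SBB X(3) by (subst mult_real_smult_left) simp_all
  finally have SF: "?S * (B * X) = quat_of_real ?d \<cdot>\<^sub>m X" .
  have BX: "B * X \<in> carrier_mat n q" using B X by auto
  have "(\<Sum>\<beta> | \<beta> \<in> index_sets r n \<and> i \<in> \<beta>. cdet \<beta> i (replace_col B i (Matrix.col (B * X) j))) =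
      (\<Sum>\<beta> | \<beta> \<in> index_sets r n \<and> i \<in> \<beta>. cramer_sum B \<beta> i (\<lambda>l. (B * X) $$ (l, j)))"
  proof (rule sum.cong[OF refl])
    fix \<beta> assume "\<beta> \<in> {\<beta> \<in> index_sets r n. i \<in> \<beta>}"
    then have \<beta>: "\<beta> \<subseteq> {..<n}" "i \<in> \<beta>" by (auto dest: index_setsD)
    show "cdet \<beta> i (replace_col B i (Matrix.col (B * X) j)) =
        cramer_sum B \<beta> i (\<lambda>l. (B * X) $$ (l, j))"
      unfolding cdet_replace_col[OF B(1) \<beta> herm[OF \<beta>(1)]]
      using \<beta> BX ij by (intro cramer_sum_cong) (auto simp del: index_mult_mat(1) simp: subset_iff)
  qed
  also have "\<dots> = quat_of_real ?d * X $$ (i, j)"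
    unfolding adj_sum_mult_entry[OF BX ij, symmetric] SF using X(1) ij by simp
  finally have num: "(\<Sum>\<beta> | \<beta> \<in> index_sets r n \<and> i \<in> \<beta>.
    cdet \<beta> i (replace_col B i (Matrix.col (B * X) j))) = X $$ (i, j) * quat_of_real ?d"
    by (simp only: quat_of_real_commute)
  show ?thesis
    unfolding num sum_hdet_eq_minor_sum[OF B r(2)] divide_quat_def using nz by (simp add: mult.assoc)
qed

text \<open>Supplies the inverse of a positive definite matrix and the weighted least squares
  inverse.\<close>

lemma hermitian_ginverse:
  assumes B: "B \<in> carrier_mat n n" "qhermitian B"
  obtains W where "W \<in> carrier_mat n n" "qhermitian W" "B * W * B = B"
proof -
  obtain s where nz: "minor_sum B n s \<noteq> 0"
    and SBB: "adj_sum B n s * B * B = quat_of_real (minor_sum B n s) \<cdot>\<^sub>m B"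
    using exists_top_minor_sum[OF B] by metis
  let ?S = "adj_sum B n s" and ?d = "minor_sum B n s"
  have [simp]: "dim_row B = n" "dim_col B = n" using B by auto
  have com: "B * ?S = ?S * B" and S: "qadj ?S = ?S"
    using adj_sum_commute_hermitian[OF B, of s] by auto
  \<comment> \<open>The factors commute, so the product is Hermitian. In \<open>B * ?W * B\<close>
    the scalar \<open>?d\<close> appears twice, which the coefficient compensates.\<close>
  let ?W = "quat_of_real (1 / ?d\<^sup>2) \<cdot>\<^sub>m (?S * ?S * B)"
  have "qadj (?S * ?S * B) = B * ?S * ?S"
    using S B by (simp add: qadj_mult qhermitian_def mult_mat_assoc)
  also have "\<dots> = ?S * B * ?S" by (simp only: com)
  also have "\<dots> = ?S * (B * ?S)" by (simp add: mult_mat_assoc)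
  also have "\<dots> = ?S * (?S * B)" by (simp only: com)
  also have "\<dots> = ?S * ?S * B" by (simp add: mult_mat_assoc)
  finally have W: "qhermitian ?W" by (simp add: qhermitian_def qadj_real_smult del: quat_of_real_simps)
  have "B * (?S * ?S * B) * B = (B * ?S) * (?S * B * B)" by (simp add: mult_mat_assoc)
  then have "B * (?S * ?S * B) * B = quat_of_real ?d \<cdot>\<^sub>m (quat_of_real ?d \<cdot>\<^sub>m B)"
    unfolding com SBB by (simp add: mult_real_smult_right SBB)
  then have "B * ?W * B = quat_of_real (1 / ?d\<^sup>2) \<cdot>\<^sub>m (quat_of_real ?d \<cdot>\<^sub>m (quat_of_real ?d \<cdot>\<^sub>m B))"
    by (simp add: mult_real_smult_left mult_real_smult_right del: quat_of_real_simps)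
  also have "\<dots> = quat_of_real (1 / ?d\<^sup>2 * ?d * ?d) \<cdot>\<^sub>m B"
    by (simp only: real_smult_smult mult.assoc)
  also have "1 / ?d\<^sup>2 * ?d * ?d = 1" using nz by (simp add: power2_eq_square)
  also have "quat_of_real 1 \<cdot>\<^sub>m B = B" by (intro eq_matI) simp_all
  finally have "B * ?W * B = B" .
  then show ?thesis using W that[of ?W] by (simp add: carrier_matI)
qed

section \<open>Weighted Moore-Penrose inverses\<close>

text \<open>A generalized inverse \<open>W\<close> gives \<open>P * (W * P - 1) = 0\<close>;
  definiteness makes the bracket vanish, and the adjoint yields the other side.\<close>

lemma qpositive_definite_inverse:
  assumes P: "P \<in> carrier_mat n n" "qpositive_definite P"
  shows "qmat_inv P \<in> carrier_mat n n" "qhermitian (qmat_inv P)"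
    "P * qmat_inv P = 1\<^sub>m n" "qmat_inv P * P = 1\<^sub>m n"
proof -
  have herm: "qhermitian P" using P by (simp add: qpositive_definite_def)
  obtain W where W: "W \<in> carrier_mat n n" "qhermitian W" "P * W * P = P"
    using hermitian_ginverse[OF P(1) herm] by blast
  have [simp]: "dim_row P = n" "dim_col P = n" "dim_row W = n" "dim_col W = n" using P W by auto
  let ?E = "W * P - 1\<^sub>m n"
  have "P * ?E = P * (W * P) - P * 1\<^sub>m n"
    by (rule mult_mat_diff_distrib) simp_all
  also have "\<dots> = 0\<^sub>m n n" using W P by (simp add: mult_mat_assoc)
  finally have "qadj ?E * P * ?E = 0\<^sub>m n n" by (simp add: mult_mat_assoc)
  then have "?E = 0\<^sub>m n n"
    by (rule qpositive_definite_eq_zero[OF P carrier_matI, rotated 2]) simp_all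
  then have WP: "W * P = 1\<^sub>m n" by (rule mat_diff_eq_zero[OF carrier_matI carrier_matI, rotated 4]) simp_all
  have "P * W = qadj (W * P)" using herm W(2) by (simp add: qadj_mult qhermitian_def)
  then have PW: "P * W = 1\<^sub>m n" unfolding WP by simp
  have "qmat_inv P = W"
    unfolding qmat_inv_def
  proof (rule the_equality)
    show "inverts_mat P W \<and> inverts_mat W P" using WP PW by (simp add: inverts_mat_def)
    \<comment> \<open>\<open>inverts_mat\<close> leaves the shape of \<open>X\<close> open; it is
      read off from the two products.\<close>
    fix X assume X: "inverts_mat P X \<and> inverts_mat X P"
    then have PX: "P * X = 1\<^sub>m n" and XP: "X * P = 1\<^sub>m (dim_row X)" by (simp_all add: inverts_mat_def)
    have [simp]: "dim_col X = n" using arg_cong[OF PX, of dim_col] by simp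
    have [simp]: "dim_row X = n" using arg_cong[OF XP, of dim_col] by simp
    have "X = X * (P * W)" by (simp add: PW)
    also have "\<dots> = X * P * W" by (simp add: mult_mat_assoc)
    also have "\<dots> = W" using XP W by simp
    finally show "X = W" .
  qed
  with W WP PW show "qmat_inv P \<in> carrier_mat n n" "qhermitian (qmat_inv P)"
    "P * qmat_inv P = 1\<^sub>m n" "qmat_inv P * P = 1\<^sub>m n" by simp_all
qed

text \<open>Keeps only anisotropy of the form, which passes easily from \<open>N\<close> to its
  inverse, so that \<open>M\<close> and the inverse of \<open>N\<close> can serve alike as
  weights.\<close>

definition qdefinite :: "quat mat \<Rightarrow> bool" where
  "qdefinite P \<longleftrightarrow> qhermitian P \<and>
     (\<forall>k. \<forall>E \<in> carrier_mat (dim_row P) k. qadj E * P * E = 0\<^sub>m k k \<longrightarrow> E = 0\<^sub>m (dim_row P) k)"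

lemma qdefiniteD:
  assumes "P \<in> carrier_mat n n" "qdefinite P" "E \<in> carrier_mat n k" "qadj E * P * E = 0\<^sub>m k k"
  shows "E = 0\<^sub>m n k"
  using assms unfolding qdefinite_def by (metis carrier_matD(1))

lemma qpositive_definite_qdefinite:
  assumes "P \<in> carrier_mat n n" "qpositive_definite P"
  shows "qdefinite P"
  using assms qpositive_definite_eq_zero[OF assms] unfolding qdefinite_def
  by (auto simp: qpositive_definite_def)

text \<open>The substitution \<open>E = P * ?G\<close> turns the form of the inverse into that of
  \<open>P\<close>.\<close>

lemma qpositive_definite_qdefinite_inverse:
  assumes P: "P \<in> carrier_mat n n" "qpositive_definite P"
  shows "qdefinite (qmat_inv P)"
proof -
  note inv = qpositive_definite_inverse[OF P]
  have [simp]: "dim_row P = n" "dim_col P = n" "dim_row (qmat_inv P) = n" "dim_col (qmat_inv P) = n"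
    using P inv by auto
  have "E = 0\<^sub>m n k" if E: "E \<in> carrier_mat n k" "qadj E * qmat_inv P * E = 0\<^sub>m k k" for E k
  proof -
    have [simp]: "dim_row E = n" "dim_col E = k" using E by auto
    let ?G = "qmat_inv P * E"
    have "qadj ?G * P * ?G = qadj E * qmat_inv P * (P * qmat_inv P) * E"
      using inv(2) by (simp add: qadj_mult qhermitian_def mult_mat_assoc)
    also have "\<dots> = 0\<^sub>m k k" using E inv by (simp add: mult_mat_assoc)
    finally have "?G = 0\<^sub>m n k"
      by (rule qpositive_definite_eq_zero[OF P carrier_matI, rotated 2]) simp_all
    have "E = P * qmat_inv P * E" unfolding inv(3) using E by simp
    also have "\<dots> = P * ?G" by (simp add: mult_mat_assoc)
    finally show ?thesis unfolding \<open>?G = 0\<^sub>m n k\<close> using P by simp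
  qed
  then show ?thesis using inv(2) by (simp add: qdefinite_def)
qed

text \<open>Solves the normal equations: with a Hermitian generalized inverse \<open>W\<close> of
  the Gram matrix \<open>qadj A * P * A\<close>, the witness is \<open>W * qadj A * P\<close>. The
  defect \<open>A * (W * ?K) - A\<close> has vanishing form, hence is zero.\<close>

lemma exists_weighted_least_squares_inverse:
  assumes A: "A \<in> carrier_mat m n" and P: "P \<in> carrier_mat m m" "qdefinite P"
  obtains Z where "Z \<in> carrier_mat n m" "A * Z * A = A" "qhermitian (P * A * Z)"
proof -
  have [simp]: "dim_row A = m" "dim_col A = n" "dim_row P = m" "dim_col P = m" using A P by auto
  have hP: "qadj P = P" using P by (simp add: qdefinite_def qhermitian_def)
  let ?K = "qadj A * P * A"
  have K: "?K \<in> carrier_mat n n" "qhermitian ?K"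
    using A P by (auto simp: qhermitian_def qadj_mult hP mult_mat_assoc)
  obtain W where W: "W \<in> carrier_mat n n" "qhermitian W" "?K * W * ?K = ?K"
    using hermitian_ginverse[OF K] by blast
  have [simp]: "dim_row W = n" "dim_col W = n" using W by auto
  let ?F = "W * ?K - 1\<^sub>m n"
  let ?E = "A * ?F"
  have "A * ?F = A * (W * ?K) - A * 1\<^sub>m n"
    by (rule mult_mat_diff_distrib) simp_all
  then have E: "?E = A * (W * ?K) - A" using A by simp
  have "?K * ?F = ?K * (W * ?K) - ?K * 1\<^sub>m n"
    by (rule mult_mat_diff_distrib) simp_all
  also have "\<dots> = 0\<^sub>m n n" using W(3) K by (simp add: mult_mat_assoc)
  finally have "?K * ?F = 0\<^sub>m n n" .
  have "qadj ?E * P * ?E = qadj ?F * (?K * ?F)" by (simp add: qadj_mult mult_mat_assoc)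
  also have "\<dots> = 0\<^sub>m n n" unfolding \<open>?K * ?F = 0\<^sub>m n n\<close> by simp
  finally have "?E = 0\<^sub>m m n"
    by (rule qdefiniteD[OF P carrier_matI, rotated 2]) simp_all
  then have "A * (W * ?K) = A" unfolding E by (rule mat_diff_eq_zero[OF carrier_matI carrier_matI, rotated 4]) simp_all
  then have "A * (W * qadj A * P) * A = A" by (simp add: mult_mat_assoc)
  moreover have "qhermitian (P * A * (W * qadj A * P))"
    using W(2) by (simp add: qhermitian_def qadj_mult hP mult_mat_assoc)
  ultimately show ?thesis using that[of "W * qadj A * P"] A W P by auto
qed

locale weighted_matrix =
  fixes A M N :: "quat mat" and m n :: nat
  assumes A: "A \<in> carrier_mat m n"
    and M: "M \<in> carrier_mat m m" "qpositive_definite M"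
    and N: "N \<in> carrier_mat n n" "qpositive_definite N"
begin

abbreviation "Mi \<equiv> qmat_inv M"
abbreviation "Ni \<equiv> qmat_inv N"

lemmas invM = qpositive_definite_inverse[OF M]
lemmas invN = qpositive_definite_inverse[OF N]

lemma dims [simp]:
  "dim_row A = m" "dim_col A = n" "dim_row M = m" "dim_col M = m" "dim_row N = n" "dim_col N = n"
  "dim_row Mi = m" "dim_col Mi = m" "dim_row Ni = n" "dim_col Ni = n"
  using A M N invM invN by auto

lemma herm [simp]: "qadj M = M" "qadj N = N" "qadj Mi = Mi" "qadj Ni = Ni"
  using M N invM invN by (simp_all add: qpositive_definite_def qhermitian_def)

text \<open>Products are kept nested to the right, so the cancellations also come with a trailing
  factor \<open>Z\<close> for use inside longer products.\<close>

lemma cancel [simp]: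
  "dim_row Z = m \<Longrightarrow> M * (Mi * Z) = Z" "dim_row Z = m \<Longrightarrow> Mi * (M * Z) = Z"
  "dim_row Z = n \<Longrightarrow> N * (Ni * Z) = Z" "dim_row Z = n \<Longrightarrow> Ni * (N * Z) = Z"
  "M * Mi = 1\<^sub>m m" "Mi * M = 1\<^sub>m m" "N * Ni = 1\<^sub>m n" "Ni * N = 1\<^sub>m n"
  using invM invN by (simp_all add: mult_mat_assoc[symmetric] left_mult_one_mat' )

end

locale weighted_MP = weighted_matrix +
  fixes X :: "quat mat"
  assumes MP: "is_weighted_MP_inverse M N A X"
begin

lemma X: "X \<in> carrier_mat n m"
  using MP by (simp add: is_weighted_MP_inverse_def)

lemma dimX [simp]: "dim_row X = n" "dim_col X = m"
  using X by auto

lemma AXA: "A * (X * A) = A" and XAX: "X * (A * X) = X"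
  and MAX: "qadj X * (qadj A * M) = M * (A * X)"
  and NXA: "qadj A * (qadj X * N) = N * (X * A)"
  using MP by (simp_all add: is_weighted_MP_inverse_def qadj_mult mult_mat_assoc)

lemma AXA': "dim_row Z = n \<Longrightarrow> A * (X * (A * Z)) = A * Z"
  using AXA by (simp add: mult_mat_assoc[symmetric])

lemma MAX': "dim_row Z = m \<Longrightarrow> qadj X * (qadj A * (M * Z)) = M * (A * (X * Z))"
  using MAX by (simp add: mult_mat_assoc[symmetric])

lemma NXA': "dim_row Z = n \<Longrightarrow> qadj A * (qadj X * (N * Z)) = N * (X * (A * Z))"
  using NXA by (simp add: mult_mat_assoc[symmetric])

lemma AXA_adj: "qadj A * (qadj X * qadj A) = qadj A"
  using arg_cong[OF AXA, of qadj] by (simp add: qadj_mult mult_mat_assoc)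

lemma AXA_adj': "dim_row Z = m \<Longrightarrow> qadj A * (qadj X * (qadj A * Z)) = qadj A * Z"
  using AXA_adj by (simp add: mult_mat_assoc[symmetric])

end

section \<open>Column rank under multiplication from the left\<close>

lemma right_indep_cols_mult_left:
  assumes "right_indep_cols (P * A) S" "S \<subseteq> {..<dim_col A}" "dim_col P = dim_row A"
  shows "right_indep_cols A S"
  unfolding right_indep_cols_def
proof (intro allI impI)
  fix c assume c: "\<forall>i<dim_row A. (\<Sum>j\<in>S. A $$ (i, j) * c j) = 0"
  have "(\<Sum>j\<in>S. (P * A) $$ (i, j) * c j) = 0" if i: "i < dim_row P" for i
  proof -
    have "(\<Sum>j\<in>S. (P * A) $$ (i, j) * c j) =
        (\<Sum>j\<in>S. \<Sum>k<dim_row A. P $$ (i, k) * (A $$ (k, j) * c j))"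
      using assms i by (intro sum.cong refl)
        (auto simp: mult_mat_entry sum_distrib_right mult.assoc simp del: index_mult_mat(1))
    also have "\<dots> = (\<Sum>k<dim_row A. P $$ (i, k) * (\<Sum>j\<in>S. A $$ (k, j) * c j))"
      by (subst sum.swap) (simp add: sum_distrib_left)
    also have "\<dots> = 0" using c by simp
    finally show ?thesis .
  qed
  then show "\<forall>j\<in>S. c j = 0" using assms(1) unfolding right_indep_cols_def by simp
qed

text \<open>Matrices obtained from each other by left multiplication have the same right linear
  relations between their columns.\<close>

lemma qrank_mult_left:
  assumes "A = Q * (P * A)" "dim_col P = dim_row A" "dim_col Q = dim_row P"
  shows "qrank (P * A) = qrank A"
proof -
  have "right_indep_cols (P * A) S \<longleftrightarrow> right_indep_cols A S" if "S \<subseteq> {..<dim_col A}" for S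
    using right_indep_cols_mult_left[of P A S] right_indep_cols_mult_left[of Q "P * A" S]
      assms that by auto
  then show ?thesis unfolding qrank_def by (metis (no_types, lifting) index_mult_mat(3))
qed

section \<open>Existence and uniqueness of the weighted Moore-Penrose inverse\<close>

context weighted_matrix
begin

text \<open>Both \<open>Z\<close> and \<open>qadj Y\<close> are generalized inverses of
  \<open>A\<close>; \<open>Z\<close> satisfies the condition for \<open>M\<close>,
  \<open>qadj Y\<close> that for \<open>N\<close>. The product \<open>qadj Y * A * Z\<close>
  inherits both.\<close>

lemma exists_MP: "\<exists>X. is_weighted_MP_inverse M N A X"
proof -
  obtain Z where Z: "Z \<in> carrier_mat n m" "A * Z * A = A" "qhermitian (M * A * Z)"
    using exists_weighted_least_squares_inverse[OF A M(1) qpositive_definite_qdefinite[OF M]] by blast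
  have A': "qadj A \<in> carrier_mat n m" using A by simp
  \<comment> \<open>The least squares inverse of the adjoint, with the inverse of \<open>N\<close>
    as weight; taking adjoints turns it into a condition on \<open>N * qadj Y * A\<close>.\<close>
  obtain Y where Y: "Y \<in> carrier_mat m n" "qadj A * Y * qadj A = qadj A"
      "qhermitian (Ni * qadj A * Y)"
    using exists_weighted_least_squares_inverse[OF A' invN(1) qpositive_definite_qdefinite_inverse[OF N]]
    by blast
  have [simp]: "dim_row Z = n" "dim_col Z = m" "dim_row Y = m" "dim_col Y = n" using Y Z by auto
  have AZA: "A * (Z * A) = A" using Z(2) by (simp add: mult_mat_assoc)
  have AYA: "A * (qadj Y * A) = A"
    using arg_cong[OF Y(2), of qadj] by (simp add: qadj_mult mult_mat_assoc)
  have AZA': "A * (Z * (A * V)) = A * V" if "dim_row V = n" for V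
    using AZA that by (simp add: mult_mat_assoc[symmetric])
  have AYA': "A * (qadj Y * (A * V)) = A * V" if "dim_row V = n" for V
    using AYA that by (simp add: mult_mat_assoc[symmetric])
  let ?X = "qadj Y * A * Z"
  have hY: "Ni * (qadj A * Y) = qadj Y * (A * Ni)"
    using Y(3) by (simp add: qhermitian_def qadj_mult mult_mat_assoc)
  have "N * (qadj Y * A) = N * (qadj Y * (A * Ni)) * N" by (simp add: mult_mat_assoc)
  also have "\<dots> = qadj A * (Y * N)" unfolding hY[symmetric] by (simp add: mult_mat_assoc)
  finally have NY: "N * (qadj Y * A) = qadj A * (Y * N)" .
  have "qadj (M * A * ?X) = M * A * ?X"
    using Z(3) by (simp add: mult_mat_assoc AYA' qhermitian_def)
  moreover have "qadj (N * ?X * A) = N * ?X * A"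
    by (simp add: mult_mat_assoc AZA) (simp add: NY qadj_mult mult_mat_assoc)
  ultimately have "is_weighted_MP_inverse M N A ?X"
    unfolding is_weighted_MP_inverse_def
    by (simp add: mult_mat_assoc AZA AYA AZA' AYA' carrier_matI)
  then show ?thesis by blast
qed

end

text \<open>\<open>A * X\<close> and \<open>A * X'\<close> are projectors with the same range,
  self-adjoint for the weight \<open>M\<close>, hence equal; \<open>X * A\<close> and
  \<open>X' * A\<close> share their kernel and are self-adjoint for \<open>N\<close>. Thus
  \<open>X = X * A * X' = X'\<close>.\<close>

lemma (in weighted_MP) MP_unique:
  assumes "is_weighted_MP_inverse M N A X'"
  shows "X' = X"
proof -
  interpret other: weighted_MP A M N m n X' by unfold_locales (rule assms)
  have "M * (A * X) = qadj X * (qadj A * M)" by (simp add: MAX)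
  also have "\<dots> = qadj X * (qadj A * (qadj X' * (qadj A * M)))" by (simp add: other.AXA_adj')
  also have "\<dots> = M * (A * (X * (A * X')))" by (simp add: other.MAX MAX')
  also have "\<dots> = M * (A * X')" by (simp add: AXA')
  finally have "Mi * (M * (A * X)) = Mi * (M * (A * X'))" by simp
  then have AX: "A * X = A * X'" by simp
  have "N * (X * A) = qadj A * (qadj X * N)" by (simp add: NXA)
  also have "\<dots> = qadj A * (qadj X' * (qadj A * (qadj X * N)))" by (simp add: other.AXA_adj')
  also have "\<dots> = N * (X' * (A * (X * A)))" by (simp add: NXA other.NXA')
  also have "\<dots> = N * (X' * A)" by (simp add: AXA)
  finally have "Ni * (N * (X * A)) = Ni * (N * (X' * A))" by simp
  then have XA: "X * A = X' * A" by simp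
  have "X = X * (A * X)" by (simp add: XAX)
  also have "\<dots> = X * A * X'" unfolding AX by (simp add: mult_mat_assoc)
  also have "\<dots> = X'" unfolding XA by (simp add: mult_mat_assoc other.XAX)
  finally show ?thesis by simp
qed

lemma (in weighted_matrix) weighted_MP_inverse_MP:
  "weighted_MP A M N m n (weighted_MP_inverse M N A)"
proof -
  obtain X where mp: "is_weighted_MP_inverse M N A X" using exists_MP by blast
  interpret weighted_MP A M N m n X by unfold_locales (rule mp)
  have "weighted_MP_inverse M N A = X"
    unfolding weighted_MP_inverse_def using mp MP_unique by (rule the_equality)
  then show ?thesis by (simp add: weighted_MP_axioms)
qed

section \<open>Range identities and the two determinantal formulas\<close>

context weighted_MP
begin

abbreviation "Sh \<equiv> wsharp M N A"
text \<open>With the weighted adjoint \<open>Mi * qadj X * N\<close> of \<open>X\<close> in the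
  middle, this one matrix factors \<open>X\<close> through both \<open>Sh * A\<close> on the left
  and \<open>A * Sh\<close> on the right.\<close>

abbreviation "W \<equiv> X * (Mi * (qadj X * (N * X)))"

lemma Sh_eq: "Sh = Ni * (qadj A * M)"
  by (simp add: wsharp_def mult_mat_assoc)

lemma dimSh [simp]: "dim_row Sh = n" "dim_col Sh = m"
  by (simp_all add: Sh_eq)

text \<open>\<open>A * X\<close> is its own weighted adjoint, so this is the weighted adjoint of
  \<open>A * X * A = A\<close>. It identifies the right-hand side in Cramer's rule.\<close>

lemma Sh_A_X: "Sh * A * X = Sh"
  by (simp add: Sh_eq mult_mat_assoc MAX[symmetric] AXA_adj')

lemma X_eq_range: "X = Sh * A * W"
  by (simp add: Sh_eq mult_mat_assoc MAX'[symmetric] AXA_adj' NXA' XAX)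

lemma X_A_Sh: "X * (A * Sh) = Sh"
proof -
  have "X * (A * Sh) = Ni * (N * (X * (A * (Ni * (qadj A * M)))))" by (simp add: Sh_eq)
  also have "\<dots> = Sh" by (simp add: NXA'[symmetric] AXA_adj' Sh_eq)
  finally show ?thesis .
qed

lemma X_eq_row_range: "X = W * (A * Sh)"
  by (simp add: mult_mat_assoc X_A_Sh) (simp add: Sh_eq MAX XAX)

text \<open>The weighted adjoint of \<open>X\<close> recovers \<open>A\<close> from
  \<open>Sh * A\<close> by left multiplication.\<close>

lemma qrank_Sh_A: "qrank (Sh * A) = qrank A"
proof (rule qrank_mult_left[of _ "Mi * (qadj X * N)"])
  have "A = Mi * (M * (A * (X * A)))" by (simp add: AXA)
  also have "\<dots> = Mi * (qadj X * N) * (Sh * A)" by (simp add: MAX'[symmetric] Sh_eq mult_mat_assoc)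
  finally show "A = Mi * (qadj X * N) * (Sh * A)" .
qed simp_all

text \<open>Together with the evident factorization of \<open>A * Sh\<close>, this shows that
  \<open>A\<close> and \<open>A * Sh\<close> have the same column space.\<close>

lemma A_eq_range: "A = (A * Sh) * (A * (W * A))"
proof -
  have "A = A * ((Sh * A * W) * A)" using AXA by (simp only: X_eq_range[symmetric])
  then show ?thesis by (simp add: mult_mat_assoc)
qed

theorem column_formula:
  assumes r: "qrank A = r" "r \<ge> 1" and herm: "qhermitian (Sh * A)" and ij: "i < n" "j < m"
  shows "X $$ (i, j) = (\<Sum>\<beta> | \<beta> \<in> index_sets r n \<and> i \<in> \<beta>.
      cdet \<beta> i (replace_col (Sh * A) i (Matrix.col Sh j))) / (\<Sum>\<beta>\<in>index_sets r n. hdet \<beta> (Sh * A))"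
proof -
  have carr: "Sh * A \<in> carrier_mat n n" "1\<^sub>m n \<in> carrier_mat n n" "W \<in> carrier_mat n m"
    by (rule carrier_matI; simp)+
  have H: "Sh * A = Sh * A * 1\<^sub>m n" using right_mult_one_mat[OF carr(1)] by (rule sym)
  have "qrank (Sh * A) = r" using qrank_Sh_A r(1) by simp
  \<comment> \<open>Here \<open>Sh * A\<close> itself carries the rank, so both factors are identity
    matrices.\<close>
  from hermitian_cramer_rule[OF carr(1) herm carr(1,2,2) H H this r(2) X carr(3) X_eq_range ij]
  show ?thesis unfolding Sh_A_X .
qed

text \<open>The adjoint of \<open>X\<close> solves the column problem for \<open>A * Sh\<close> with
  right-hand side \<open>qadj Sh\<close>. Conjugating the resulting quotient turns column into row
  determinants and leaves the real denominator unchanged.\<close>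

theorem row_formula:
  assumes r: "qrank A = r" "r \<ge> 1" and herm: "qhermitian (A * Sh)" and ij: "i < n" "j < m"
  shows "X $$ (i, j) = (\<Sum>\<alpha> | \<alpha> \<in> index_sets r m \<and> j \<in> \<alpha>.
      rdet \<alpha> j (replace_row (A * Sh) j (Matrix.row Sh i))) / (\<Sum>\<alpha>\<in>index_sets r m. hdet \<alpha> (A * Sh))"
proof -
  let ?G = "A * Sh"
  have G: "?G \<in> carrier_mat m m" "qadj ?G = ?G"
  proof -
    show "?G \<in> carrier_mat m m" by (rule carrier_matI) simp_all
    show "qadj ?G = ?G" using herm unfolding qhermitian_def .
  qed
  have carr: "Sh \<in> carrier_mat n m" "A * (W * A) \<in> carrier_mat m n" "qadj X \<in> carrier_mat m n"
    "qadj W \<in> carrier_mat m n"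
    by (rule carrier_matI; simp)+
  have "qadj X = qadj (W * ?G)" using X_eq_row_range by simp
  also have "\<dots> = qadj ?G * qadj W" by (rule qadj_mult) simp
  finally have X': "qadj X = ?G * qadj W" unfolding G(2) .
  have "?G * qadj X = qadj (X * ?G)" using G(2) by (simp add: qadj_mult)
  then have F: "?G * qadj X = qadj Sh" unfolding X_A_Sh .
  let ?num = "\<Sum>\<alpha> | \<alpha> \<in> index_sets r m \<and> j \<in> \<alpha>. cdet \<alpha> j (replace_col ?G j (Matrix.col (qadj Sh) i))"
  \<comment> \<open>Now \<open>A\<close> carries the rank, with the factors \<open>Sh\<close> and
    \<open>A * (W * A)\<close>.\<close>
  have "qadj X $$ (j, i) = ?num / (\<Sum>\<alpha>\<in>index_sets r m. hdet \<alpha> ?G)"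
    using hermitian_cramer_rule[OF G(1) herm A carr(1,2) refl A_eq_range r carr(3,4) X' ij(2,1)]
    unfolding F .
  moreover have "(\<Sum>\<alpha>\<in>index_sets r m. hdet \<alpha> ?G) = quat_of_real (minor_sum ?G m r)"
    by (rule sum_hdet_eq_minor_sum[OF G(1) herm r(2)])
  ultimately have "X $$ (i, j) = qcnj (?num / quat_of_real (minor_sum ?G m r))"
    using ij by (metis dimX qadj_entry qadj_qadj qadj_dim)
  also have "\<dots> = qcnj ?num / quat_of_real (minor_sum ?G m r)"
    by (rule qcnj_divide_real)
  also have "qcnj ?num = (\<Sum>\<alpha> | \<alpha> \<in> index_sets r m \<and> j \<in> \<alpha>. rdet \<alpha> j (replace_row ?G j (Matrix.row Sh i)))"
    unfolding qcnj_sum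
  proof (rule sum.cong[OF refl])
    fix \<alpha> assume "\<alpha> \<in> {\<alpha> \<in> index_sets r m. j \<in> \<alpha>}"
    then have \<alpha>: "\<alpha> \<subseteq> {..<m}" "finite \<alpha>" "j \<in> \<alpha>" by (auto dest: index_setsD)
    let ?C = "replace_col ?G j (Matrix.col (qadj Sh) i)" and ?B = "replace_row ?G j (Matrix.row Sh i)"
    have "?C $$ (y, x) = qcnj (?B $$ (x, y))" if "x \<in> \<alpha>" "y \<in> \<alpha>" for x y
    proof -
      have xy: "x < m" "y < m" using that \<alpha> by auto
      then have "?G $$ (y, x) = qcnj (?G $$ (x, y))"
        by (intro qhermitian_entry[OF herm]) simp_all
      with xy ij show ?thesis
        by (simp add: replace_col_def replace_row_def del: index_mult_mat(1))
    qed
    then show "qcnj (cdet \<alpha> j ?C) = rdet \<alpha> j ?B"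
      using adjoint_dets[OF \<alpha>(2), of ?C ?B] \<alpha>(3) by simp
  qed
  finally show ?thesis unfolding sum_hdet_eq_minor_sum[OF G(1) herm r(2)] .
qed

end

theorem theorem4p1:
  fixes A M N :: "quat mat" and m n r :: nat
  assumes "A \<in> carrier_mat m n"
    and "qrank A = r" and "r \<ge> 1"
    and "M \<in> carrier_mat m m" and "qpositive_definite M"
    and "N \<in> carrier_mat n n" and "qpositive_definite N"
  shows "(qhermitian (wsharp M N A * A) \<longrightarrow>
           (\<forall>i<n. \<forall>j<m. weighted_MP_inverse M N A $$ (i, j) =
              (\<Sum>\<beta> | \<beta> \<in> index_sets r n \<and> i \<in> \<beta>.
                 cdet \<beta> i (replace_col (wsharp M N A * A) i (Matrix.col (wsharp M N A) j)))
              / (\<Sum>\<beta> \<in> index_sets r n. hdet \<beta> (wsharp M N A * A))))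
       \<and> (qhermitian (A * wsharp M N A) \<longrightarrow>
           (\<forall>i<n. \<forall>j<m. weighted_MP_inverse M N A $$ (i, j) =
              (\<Sum>\<alpha> | \<alpha> \<in> index_sets r m \<and> j \<in> \<alpha>.
                 rdet \<alpha> j (replace_row (A * wsharp M N A) j (Matrix.row (wsharp M N A) i)))
              / (\<Sum>\<alpha> \<in> index_sets r m. hdet \<alpha> (A * wsharp M N A))))"
proof -
  interpret weighted_matrix A M N m n by unfold_locales (use assms in auto)
  interpret weighted_MP A M N m n "weighted_MP_inverse M N A" by (rule weighted_MP_inverse_MP)
  show ?thesis using column_formula[OF assms(2,3)] row_formula[OF assms(2,3)] by blast
qed

end
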